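(* For every transfinite $\times$-number $\lambda$, the field $\mathcal{Q}_\lambda$ is Archimedean if and only if $\lambda=\omega$.
   Context: $\oplus,\otimes$ denote natural (Hessenberg) sum and product of ordinals; $\lambda$ is a transfinite $\times$-number if $\omega\le\lambda$ and $\beta\otimes\gamma<\lambda$ for all $\beta,\gamma<\lambda$. $\mathbb{Z}_\infty$ is the class of pairs $(\alpha,\beta)$ of ordinals whose Cantor normal forms share no exponent, identified with finite formal sums $\sum_\zeta\omega^\zeta c_\zeta$, $c_\zeta\in\mathbb{Z}$ (positive coefficients from $\beta$, negated from $\alpha$); $1^{st},2^{nd}$ denote coordinates. Coefficientwise addition, $-(\alpha,\beta)=(\beta,\alpha)$, multiplication $(\sum\omega^\zeta c_\zeta)(\sum\omega^\eta d_\eta)=\sum_\theta\omega^\theta\sum_{\zeta\oplus\eta=\theta}c_\zeta d_\eta$, $0=(0,0)$, $1=(0,1)$. $\mathbb{Z}_\infty^+=\{a:1^{st}a\le2^{nd}a\}$, $\mathbb{Z}_\infty^-=\{a:2^{nd}a<1^{st}a\}$; $a\le b$ iff ($a\in\mathbb{Z}_\infty^-,b\in\mathbb{Z}_\infty^+$) or ($a,b\in\mathbb{Z}_\infty^+$ and [$2^{nd}a<2^{nd}b$ or ($2^{nd}a=2^{nd}b$ and $1^{st}b\le1^{st}a$)]) or ($a,b\in\mathbb{Z}_\infty^-$ and [$1^{st}b<1^{st}a$ or ($1^{st}a=1^{st}b$ and $2^{nd}a\le2^{nd}b$)]). $\mathbb{Z}_\lambda=\{a:1^{st}a<\lambda,2^{nd}a<\lambda\}$.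 $\mathbb{Q}_\infty$: pairs $(a,b)$, $a\in\mathbb{Z}_\infty$, $b\in\mathbb{Z}_\infty^+\setminus\{0\}$, whose only common divisors in $\mathbb{Z}_\infty$ are $\pm1$. Each pair $(x,y)$ with $y$ positive nonzero is equivalent (i.e. $ux=vx'$, $uy=vy'$ for nonzero $u,v$) to exactly one element $\overline{(x,y)}$ of $\mathbb{Q}_\infty$. For $p=(a,b),q=(c,d)$: $p+q=\overline{(ad+bc,bd)}$, $-p=(-a,b)$, $pq=\overline{(ac,bd)}$; $p\le q$ iff the first coordinate of $q+(-p)$ is $\ge0$; $0=(0,1)$. $\mathcal{Q}_\lambda$ is $\mathbb{Q}_\lambda=\{(a,b)\in\mathbb{Q}_\infty:a,b\in\mathbb{Z}_\lambda\}$ with restricted order and operations. In an ordered field, $|f|=f$ if $0\le f$ and $-f$ otherwise; the field is Archimedean if for all nonzero $p,q$ there is a natural number $n$ with $|q|\le\sum_{i<n}|p|$ and $|p|\le\sum_{i<n}|q|$. *)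

theory Defs
  imports "HOL-Algebra.Ring" "HOL-Algebra.Divisibility" "HOL-Library.Infinite_Typeclass"
begin

section \<open>Ordinals\<close>

text \<open>
  HOL has no type of all ordinals. The elements of \<open>'a ordinal\<close> are the order types of the
  well-orders whose field is a subset of the type \<open>'a\<close>. For an infinite type \<open>'a\<close> these are
  precisely the ordinals of cardinality at most \<open>|UNIV :: 'a set|\<close>. They are closed under the
  operations below (in particular, the \<open>LEAST\<close> in each of these definitions exists). Every ordinal occurs for a
  suitable \<open>'a\<close>, so a theorem about \<open>'a::infinite ordinal\<close> is a theorem about all ordinals.
\<close>

quotient_type 'a ordinal = "'a rel" / partial: "\<lambda>r s. (r, s) \<in> ordIso"
proof (rule part_equivpI)
  show "\<exists>r::'a rel. (r, r) \<in> ordIso"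
    using ordIso_reflexive[of "{}"] by (intro exI[of _ "{}"]) simp
  show "symp (\<lambda>r s :: 'a rel. (r, s) \<in> ordIso)"
    by (auto intro: sympI ordIso_symmetric)
  show "transp (\<lambda>r s :: 'a rel. (r, s) \<in> ordIso)"
    by (auto intro: transpI ordIso_transitive)
qed

instantiation ordinal :: (type) "{wellorder, zero}"
begin

lift_definition less_eq_ordinal :: "'a ordinal \<Rightarrow> 'a ordinal \<Rightarrow> bool"
  is "\<lambda>r s. (r, s) \<in> ordLeq"
  by (meson ordIso_ordLeq_trans ordIso_symmetric ordLeq_ordIso_trans)

lift_definition less_ordinal :: "'a ordinal \<Rightarrow> 'a ordinal \<Rightarrow> bool"
  is "\<lambda>r s. (r, s) \<in> ordLess"
  by (meson ordIso_ordLess_trans ordIso_symmetric ordLess_ordIso_trans)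

lift_definition zero_ordinal :: "'a ordinal" is "{}"
  by (simp add: ordIso_reflexive)

instance
proof
  have WO: "Well_order (rep_ordinal x)" for x :: "'a ordinal"
    using Quotient_rep_reflp[OF Quotient_ordinal, of x] by (simp add: ordIso_def)
  have le: "x \<le> y \<longleftrightarrow> (rep_ordinal x, rep_ordinal y) \<in> ordLeq" for x y :: "'a ordinal"
    by (simp add: less_eq_ordinal_def)
  have less: "x < y \<longleftrightarrow> (rep_ordinal x, rep_ordinal y) \<in> ordLess" for x y :: "'a ordinal"
    by (simp add: less_ordinal_def)
  fix x y z :: "'a ordinal"
  show "x < y \<longleftrightarrow> x \<le> y \<and> \<not> y \<le> x"
    unfolding le less using not_ordLeq_iff_ordLess[OF WO WO] ordLess_imp_ordLeq by blast
  show "x \<le> x"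
    unfolding le by (rule ordLeq_reflexive[OF WO])
  show "x \<le> y \<Longrightarrow> y \<le> z \<Longrightarrow> x \<le> z"
    unfolding le by (rule ordLeq_transitive)
  show "x \<le> y \<Longrightarrow> y \<le> x \<Longrightarrow> x = y"
    unfolding le using Quotient_rel_rep[OF Quotient_ordinal, of x y] ordIso_iff_ordLeq by blast
  show "x \<le> y \<or> y \<le> x"
    unfolding le by (rule ordLeq_total[OF WO WO])
  fix P :: "'a ordinal \<Rightarrow> bool" and a
  assume step: "\<And>x. (\<And>y. y < x \<Longrightarrow> P y) \<Longrightarrow> P x"
  have "wf {(x, y :: 'a ordinal). x < y}"
    by (rule wf_subset[OF wf_inv_image[OF wf_ordLess, of rep_ordinal]])
      (auto simp: inv_image_def less)
  then show "P a"
    by (rule wf_induct_rule) (simp add: step)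
qed

end

subsection \<open>Ordinal arithmetic\<close>

definition osuc :: "'a ordinal \<Rightarrow> 'a ordinal" where
  "osuc \<alpha> = (LEAST \<beta>. \<alpha> < \<beta>)"

primrec ord_of_nat :: "nat \<Rightarrow> 'a ordinal" where
  "ord_of_nat 0 = 0"
| "ord_of_nat (Suc n) = osuc (ord_of_nat n)"

definition omega :: "'a ordinal" where
  "omega = (LEAST \<alpha>. \<forall>n. ord_of_nat n < \<alpha>)"

text \<open>
  Each of the following recursions treats the zero, successor and limit cases at once:
  \<open>\<alpha> + \<beta> = sup ({\<alpha>} \<union> {(\<alpha> + \<beta>') + 1 | \<beta>' < \<beta>})\<close>,
  \<open>\<alpha> \<cdot> \<beta> = sup {\<alpha> \<cdot> \<beta>' + \<alpha> | \<beta>' < \<beta>}\<close> and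
  \<open>\<omega>\<^sup>\<beta> = sup ({1} \<union> {\<omega>\<^bsup>\<beta>'\<^esup> \<cdot> \<omega> | \<beta>' < \<beta>})\<close>.
\<close>

function oadd :: "'a ordinal \<Rightarrow> 'a ordinal \<Rightarrow> 'a ordinal" where
  "oadd \<alpha> \<beta> = (LEAST \<gamma>. \<alpha> \<le> \<gamma> \<and> (\<forall>\<beta>'\<in>{..<\<beta>}. oadd \<alpha> \<beta>' < \<gamma>))"
  by auto
termination by (relation "inv_image {(x, y). x < y} snd") (simp_all add: wf)

declare oadd.simps [simp del]

function omul :: "'a ordinal \<Rightarrow> 'a ordinal \<Rightarrow> 'a ordinal" where
  "omul \<alpha> \<beta> = (LEAST \<gamma>. \<forall>\<beta>'\<in>{..<\<beta>}. oadd (omul \<alpha> \<beta>') \<alpha> \<le> \<gamma>)"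
  by auto
termination by (relation "inv_image {(x, y). x < y} snd") (simp_all add: wf)

declare omul.simps [simp del]

function omega_pow :: "'a ordinal \<Rightarrow> 'a ordinal" where
  "omega_pow \<beta> = (LEAST \<gamma>. 0 < \<gamma> \<and> (\<forall>\<beta>'\<in>{..<\<beta>}. omul (omega_pow \<beta>') omega \<le> \<gamma>))"
  by auto
termination by (relation "{(x, y). x < y}") (simp_all add: wf)

declare omega_pow.simps [simp del]

subsection \<open>Cantor normal form, natural sum and natural product\<close>

definition supp :: "('a \<Rightarrow> 'b::zero) \<Rightarrow> 'a set" where
  "supp c = {\<zeta>. c \<zeta> \<noteq> 0}"

text \<open>
  For \<open>c\<close> of finite support \<open>{\<zeta>\<^sub>1 > \<dots> > \<zeta>\<^sub>k}\<close>, the ordinal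
  \<open>\<omega>\<^bsup>\<zeta>\<^sub>1\<^esup> \<cdot> c \<zeta>\<^sub>1 + \<dots> + \<omega>\<^bsup>\<zeta>\<^sub>k\<^esup> \<cdot> c \<zeta>\<^sub>k\<close>.
\<close>

definition cnf_sum :: "('a ordinal \<Rightarrow> nat) \<Rightarrow> 'a ordinal" where
  "cnf_sum c = foldr (\<lambda>\<zeta>. oadd (omul (omega_pow \<zeta>) (ord_of_nat (c \<zeta>))))
     (rev (sorted_list_of_set (supp c))) 0"

definition cnf :: "'a ordinal \<Rightarrow> 'a ordinal \<Rightarrow> nat" where
  "cnf \<alpha> = (THE c. finite (supp c) \<and> cnf_sum c = \<alpha>)"

definition nat_sum :: "'a ordinal \<Rightarrow> 'a ordinal \<Rightarrow> 'a ordinal" where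
  "nat_sum \<alpha> \<beta> = cnf_sum (\<lambda>\<zeta>. cnf \<alpha> \<zeta> + cnf \<beta> \<zeta>)"

text \<open>The coefficients of \<open>(\<Sum>\<zeta>. \<omega>\<^sup>\<zeta> c\<^sub>\<zeta>) (\<Sum>\<eta>. \<omega>\<^sup>\<eta> d\<^sub>\<eta>)\<close> when \<open>\<omega>\<^sup>\<zeta> \<omega>\<^sup>\<eta> = \<omega>\<^sup>\<theta>\<close> for the natural sum \<open>\<theta>\<close> of
  \<open>\<zeta>\<close> and \<open>\<eta>\<close>.\<close>

definition convolution ::
    "('a ordinal \<Rightarrow> 'b::semiring_0) \<Rightarrow> ('a ordinal \<Rightarrow> 'b) \<Rightarrow> 'a ordinal \<Rightarrow> 'b" where
  "convolution c d \<theta> =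
     (\<Sum>(\<zeta>, \<eta>) \<in> {(\<zeta>, \<eta>) \<in> supp c \<times> supp d. nat_sum \<zeta> \<eta> = \<theta>}. c \<zeta> * d \<eta>)"

definition nat_prod :: "'a ordinal \<Rightarrow> 'a ordinal \<Rightarrow> 'a ordinal" where
  "nat_prod \<alpha> \<beta> = cnf_sum (convolution (cnf \<alpha>) (cnf \<beta>))"

definition transfinite_times_number :: "'a ordinal \<Rightarrow> bool" where
  "transfinite_times_number \<kappa> \<longleftrightarrow>
     omega \<le> \<kappa> \<and> (\<forall>\<beta><\<kappa>. \<forall>\<gamma><\<kappa>. nat_prod \<beta> \<gamma> < \<kappa>)"

section \<open>The integers \<open>\<int>\<^sub>\<infinity>\<close>\<close>

type_synonym 'a zpair = "'a ordinal \<times> 'a ordinal"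

text \<open>
  The pair \<open>(\<alpha>, \<beta>)\<close> stands for the difference \<open>\<beta> - \<alpha>\<close>: the first coordinate carries the negative
  coefficients of the formal sum, the second coordinate the positive ones.
\<close>

definition Z_inf :: "'a zpair set" where
  "Z_inf = {(\<alpha>, \<beta>). supp (cnf \<alpha>) \<inter> supp (cnf \<beta>) = {}}"

definition zcoeff :: "'a zpair \<Rightarrow> 'a ordinal \<Rightarrow> int" where
  "zcoeff a \<zeta> = int (cnf (snd a) \<zeta>) - int (cnf (fst a) \<zeta>)"

definition of_zcoeff :: "('a ordinal \<Rightarrow> int) \<Rightarrow> 'a zpair" where
  "of_zcoeff c = (cnf_sum (\<lambda>\<zeta>. nat (- c \<zeta>)), cnf_sum (\<lambda>\<zeta>. nat (c \<zeta>)))"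

definition Z_ring :: "'a zpair ring" where
  "Z_ring =
     \<lparr>carrier = Z_inf,
      monoid.mult = (\<lambda>a b. of_zcoeff (convolution (zcoeff a) (zcoeff b))),
      one = (0, ord_of_nat 1),
      zero = (0, 0),
      add = (\<lambda>a b. of_zcoeff (\<lambda>\<zeta>. zcoeff a \<zeta> + zcoeff b \<zeta>))\<rparr>"

definition zneg :: "'a zpair \<Rightarrow> 'a zpair" where
  "zneg a = (snd a, fst a)"

definition Z_pos :: "'a zpair set" where
  "Z_pos = {a \<in> Z_inf. fst a \<le> snd a}"

definition Z_neg :: "'a zpair set" where
  "Z_neg = {a \<in> Z_inf. snd a < fst a}"

definition zle :: "'a zpair \<Rightarrow> 'a zpair \<Rightarrow> bool" where
  "zle a b \<longleftrightarrow>
     a \<in> Z_neg \<and> b \<in> Z_pos \<or>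
     a \<in> Z_pos \<and> b \<in> Z_pos \<and> (snd a < snd b \<or> snd a = snd b \<and> fst b \<le> fst a) \<or>
     a \<in> Z_neg \<and> b \<in> Z_neg \<and> (fst b < fst a \<or> fst a = fst b \<and> snd a \<le> snd b)"

definition Z_below :: "'a ordinal \<Rightarrow> 'a zpair set" where
  "Z_below \<kappa> = {a \<in> Z_inf. fst a < \<kappa> \<and> snd a < \<kappa>}"

section \<open>The rationals \<open>\<rat>\<^sub>\<infinity>\<close> and \<open>\<rat>\<^sub>\<kappa>\<close>\<close>

type_synonym 'a qpair = "'a zpair \<times> 'a zpair"

definition Q_inf :: "'a qpair set" where
  "Q_inf = {(a, b). a \<in> Z_inf \<and> b \<in> Z_pos - {\<zero>\<^bsub>Z_ring\<^esub>} \<and>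
     (\<forall>d \<in> Z_inf. d divides\<^bsub>Z_ring\<^esub> a \<and> d divides\<^bsub>Z_ring\<^esub> b \<longrightarrow>
        d = \<one>\<^bsub>Z_ring\<^esub> \<or> d = zneg \<one>\<^bsub>Z_ring\<^esub>)}"

definition qequiv :: "'a qpair \<Rightarrow> 'a qpair \<Rightarrow> bool" where
  "qequiv p q \<longleftrightarrow>
     (\<exists>u \<in> Z_inf - {\<zero>\<^bsub>Z_ring\<^esub>}. \<exists>v \<in> Z_inf - {\<zero>\<^bsub>Z_ring\<^esub>}.
        u \<otimes>\<^bsub>Z_ring\<^esub> fst p = v \<otimes>\<^bsub>Z_ring\<^esub> fst q \<and>
        u \<otimes>\<^bsub>Z_ring\<^esub> snd p = v \<otimes>\<^bsub>Z_ring\<^esub> snd q)"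

definition qreduce :: "'a qpair \<Rightarrow> 'a qpair" where
  "qreduce p = (THE q. q \<in> Q_inf \<and> qequiv p q)"

definition qadd :: "'a qpair \<Rightarrow> 'a qpair \<Rightarrow> 'a qpair" where
  "qadd p q = qreduce
     ((fst p \<otimes>\<^bsub>Z_ring\<^esub> snd q) \<oplus>\<^bsub>Z_ring\<^esub> (snd p \<otimes>\<^bsub>Z_ring\<^esub> fst q), snd p \<otimes>\<^bsub>Z_ring\<^esub> snd q)"

definition qneg :: "'a qpair \<Rightarrow> 'a qpair" where
  "qneg p = (zneg (fst p), snd p)"

definition qmult :: "'a qpair \<Rightarrow> 'a qpair \<Rightarrow> 'a qpair" where
  "qmult p q = qreduce (fst p \<otimes>\<^bsub>Z_ring\<^esub> fst q, snd p \<otimes>\<^bsub>Z_ring\<^esub> snd q)"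

definition qle :: "'a qpair \<Rightarrow> 'a qpair \<Rightarrow> bool" where
  "qle p q \<longleftrightarrow> zle \<zero>\<^bsub>Z_ring\<^esub> (fst (qadd q (qneg p)))"

definition Q_below :: "'a ordinal \<Rightarrow> 'a qpair set" where
  "Q_below \<kappa> = {(a, b) \<in> Q_inf. a \<in> Z_below \<kappa> \<and> b \<in> Z_below \<kappa>}"

section \<open>Ordered rings and the Archimedean property\<close>

record 'a ordered_ring = "'a ring" +
  ring_le :: "'a \<Rightarrow> 'a \<Rightarrow> bool"

definition ring_abs :: "('a, 'm) ordered_ring_scheme \<Rightarrow> 'a \<Rightarrow> 'a" where
  "ring_abs F f = (if ring_le F \<zero>\<^bsub>F\<^esub> f then f else \<ominus>\<^bsub>F\<^esub> f)"

definition archimedean :: "('a, 'm) ordered_ring_scheme \<Rightarrow> bool" where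
  "archimedean F \<longleftrightarrow>
     (\<forall>p \<in> carrier F - {\<zero>\<^bsub>F\<^esub>}. \<forall>q \<in> carrier F - {\<zero>\<^bsub>F\<^esub>}. \<exists>n::nat.
        ring_le F (ring_abs F q) ([n] \<cdot>\<^bsub>F\<^esub> ring_abs F p) \<and>
        ring_le F (ring_abs F p) ([n] \<cdot>\<^bsub>F\<^esub> ring_abs F q))"

definition Q_field :: "'a ordinal \<Rightarrow> 'a qpair ordered_ring" where
  "Q_field \<kappa> =
     \<lparr>carrier = Q_below \<kappa>, monoid.mult = qmult,
      one = (\<one>\<^bsub>Z_ring\<^esub>, \<one>\<^bsub>Z_ring\<^esub>), zero = (\<zero>\<^bsub>Z_ring\<^esub>, \<one>\<^bsub>Z_ring\<^esub>),
      add = qadd, ring_le = qle\<rparr>"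

end

theory Submission
  imports Defs "HOL-Library.Poly_Mapping"
begin

text \<open>
  By existence and uniqueness of Cantor normal forms, the ordinals with the natural sum form an
  ordered cancellative monoid, and \<open>\<int>\<^sub>\<infinity>\<close> is its monoid algebra over \<open>\<int>\<close>: an integral domain, whose
  only units are \<open>\<plusminus>1\<close> by comparison of leading exponents. A fraction \<open>(gx, gy)\<close> with \<open>sx + ty = 1\<close>
  therefore reduces to \<open>(x, y)\<close>. Hence \<open>\<rat>\<^sub>\<omega>\<close> is a copy of \<open>\<rat>\<close>, which is Archimedean, while for \<open>\<kappa> > \<omega>\<close> the
  element \<open>\<omega>\<close> of \<open>\<rat>\<^sub>\<kappa>\<close> exceeds every multiple \<open>n \<cdot> 1\<close>.
\<close>

section \<open>Bounded families of ordinals\<close>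

text \<open>The recursive definitions of \<open>oadd\<close>, \<open>omul\<close> and
  \<open>omega_pow\<close> are of value only if each \<open>LEAST\<close> exists, that is, if the
  family below it is bounded inside the type \<open>'a ordinal\<close> itself. This is settled by
  counting: an initial segment has at most as many elements as \<open>'a\<close>, the whole type has
  more, so no family indexed by an initial segment is cofinal. Infinity of \<open>'a\<close> enters
  here through the absorption laws for cardinals.

  The second obstacle is that \<open>Z_ring\<close> is a record over pairs, where cancellation and
  divisibility are awkward. It is therefore replaced by finitely supported functions from ordinals
  to \<open>int\<close>. Taking \<open>nat_sum\<close> as the \<open>+\<close> of a type class turns
  the library product on these functions into the convolution of \<open>Z_ring\<close>, and an
  exponent monoid that is linearly ordered and cancellative rules out zero divisors.\<close>

lemma well_order_le: "Well_order {(x :: 'b::wellorder, y). x \<le> y}"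
  unfolding well_order_on_def linear_order_on_def partial_order_on_def preorder_on_def
proof (intro conjI)
  have [simp]: "Field {(x :: 'b, y). x \<le> y} = UNIV"
    by (auto simp: Field_def)
  show "{(x :: 'b, y). x \<le> y} \<subseteq> Field {(x :: 'b, y). x \<le> y} \<times> Field {(x :: 'b, y). x \<le> y}" by simp
  show "Refl {(x :: 'b, y). x \<le> y}" by (auto simp: refl_on_def)
  show "trans {(x :: 'b, y). x \<le> y}" by (auto simp: trans_def)
  show "antisym {(x :: 'b, y). x \<le> y}" by (auto simp: antisym_def)
  show "Total {(x :: 'b, y). x \<le> y}" by (auto simp: total_on_def)
  have "{(x :: 'b, y). x \<le> y} - Id = {(x, y). x < y}" by auto
  then show "wf ({(x :: 'b, y). x \<le> y} - Id)" by (simp add: wf)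
qed

lemma Well_order_rep_ordinal: "Well_order (rep_ordinal x)"
  using Quotient_rep_reflp[OF Quotient_ordinal, of x] by (simp add: ordIso_def)

lemma abs_ordinal_less_iff:
  assumes "Well_order r" "Well_order s"
  shows "abs_ordinal r < abs_ordinal s \<longleftrightarrow> (r, s) \<in> ordLess"
  using assms by (simp add: less_ordinal.abs_eq ordIso_reflexive)

text \<open>The Burali-Forti argument: the order type of all ordinals, transported along \<open>g\<close>, would be a
  largest one.\<close>

lemma no_inj_ordinal: "\<not> inj (g :: 'a ordinal \<Rightarrow> 'a)"
proof
  assume g: "inj g"
  define R where "R = dir_image {(x :: 'a ordinal, y). x \<le> y} g"
  have WO: "Well_order R"
    unfolding R_def by (rule Well_order_dir_image[OF well_order_le]) (use g in \<open>auto intro: inj_on_subset\<close>)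
  have R: "(g x, g y) \<in> R \<longleftrightarrow> x \<le> y" for x y
    using g by (auto simp: R_def dir_image_def inj_eq)
  have F: "g x \<in> Field R" for x
    using R[of x x] by (auto simp: Field_def)
  define I where "I x = Restr R (underS R (g x))" for x
  have WI: "Well_order (I x)" for x
    unfolding I_def using WO by (rule Well_order_Restr)
  have of: "wo_rel.ofilter R (underS R (g x))" for x
    using WO by (simp add: wo_rel_def wo_rel.underS_ofilter)
  have less: "(I x, I y) \<in> ordLess" if "x < y" for x y
  proof -
    have "underS R (g x) \<subset> underS R (g y)"
    proof
      show "underS R (g x) \<subseteq> underS R (g y)"
        using that g unfolding underS_def R_def dir_image_def by (auto simp: inj_eq)
      have "g x \<in> underS R (g y)" "g x \<notin> underS R (g x)"
        using that g by (auto simp: underS_def R inj_eq)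
      then show "underS R (g x) \<noteq> underS R (g y)" by blast
    qed
    then show ?thesis
      unfolding I_def using ofilter_subset_ordLess[OF WO of of] by blast
  qed
  \<comment> \<open>\<open>t x\<close> is the order type of the ordinals below \<open>x\<close>,
    measured inside \<open>R\<close>. Being strictly increasing, it satisfies
    \<open>x \<le> t x\<close>, which fails when \<open>x\<close> is the order type of
    \<open>R\<close> itself.\<close>
  define t where "t x = abs_ordinal (I x)" for x
  have mono: "t x < t y" if "x < y" for x y
    unfolding t_def using less[OF that] WI by (simp add: abs_ordinal_less_iff)
  have le: "x \<le> t x" for x
  proof (induction x rule: less_induct)
    case (less x)
    show ?case
    proof (rule ccontr)
      assume "\<not> x \<le> t x"
      then have *: "t x < x" by simp
      from less[OF *] mono[OF *] show False by simp
    qed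
  qed
  have "t (abs_ordinal R) < abs_ordinal R"
    unfolding t_def I_def using underS_Restr_ordLess[OF WO] F WO WI[unfolded I_def]
    by (subst abs_ordinal_less_iff) auto
  with le[of "abs_ordinal R"] show False
    by simp
qed

unbundle cardinal_syntax

text \<open>Each \<open>y < x\<close> is the order type of a segment of \<open>rep_ordinal x\<close>
  cut off at some element of \<open>'a\<close>. Choosing such an element is injective, because it
  determines the segment and hence \<open>y\<close>. The extra point \<open>x\<close> is absorbed
  since \<open>'a\<close> is infinite.\<close>

lemma card_of_atMost_ordinal:
  fixes x :: "'a::infinite ordinal"
  shows "|{..x}| \<le>o |UNIV :: 'a set|"
proof -
  define s where "s y = (SOME a. (rep_ordinal y, Restr (rep_ordinal x) (underS (rep_ordinal x) a)) \<in> ordIso)" for y :: "'a ordinal"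
  have s: "(rep_ordinal y, Restr (rep_ordinal x) (underS (rep_ordinal x) (s y))) \<in> ordIso" if "y < x" for y :: "'a ordinal"
  proof -
    have "(rep_ordinal y, rep_ordinal x) \<in> ordLess"
      using that by (simp add: less_ordinal_def)
    then obtain a where "(rep_ordinal y, Restr (rep_ordinal x) (underS (rep_ordinal x) a)) \<in> ordIso"
      using iffD1[OF ordLess_iff_ordIso_Restr[OF Well_order_rep_ordinal Well_order_rep_ordinal], of y x]
      by (elim meta_impE bexE)
    then show ?thesis
      unfolding s_def by (rule someI)
  qed
  have "inj_on s {..<x}"
  proof (rule inj_onI)
    fix y z assume "y \<in> {..<x}" and z: "z \<in> {..<x}" and eq: "s y = s z"
    then have "(rep_ordinal y, Restr (rep_ordinal x) (underS (rep_ordinal x) (s z))) \<in> ordIso"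
      using s[of y] by simp
    from ordIso_transitive[OF this ordIso_symmetric[OF s[of z]]]
    have "(rep_ordinal y, rep_ordinal z) \<in> ordIso"
      using z by simp
    then show "y = z"
      using Quotient_rel_rep[OF Quotient_ordinal, of y z] by simp
  qed
  then have "|{..<x}| \<le>o |UNIV :: 'a set|"
    by (rule card_of_ordLeqI) simp
  then have "|{x} \<union> {..<x}| \<le>o |UNIV :: 'a set|"
    by (intro card_of_Un_ordLeq_infinite_Field card_of_singl_ordLeq)
      (simp_all add: Field_card_of infinite_UNIV card_of_card_order_on)
  moreover have "{x} \<union> {..<x} = {..x}" by auto
  ultimately show ?thesis by simp
qed

text \<open>Were the values cofinal, the segments \<open>{..f y}\<close> would cover the type. A
  union of at most |\<open>'a\<close>| sets of size at most |\<open>'a\<close>| would then contain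
  all ordinals, against \<open>no_inj_ordinal\<close>.\<close>

lemma bounded_ordinal_image:
  fixes f :: "'a::infinite ordinal \<Rightarrow> 'a ordinal"
  shows "\<exists>\<gamma>. \<forall>y<x. f y < \<gamma>"
proof (rule ccontr)
  assume "\<nexists>\<gamma>. \<forall>y<x. f y < \<gamma>"
  then have "\<exists>y<x. \<gamma> \<le> f y" for \<gamma>
    by (meson not_less)
  then have "\<exists>y\<in>{..x}. \<gamma> \<in> {..f y}" for \<gamma>
    by (meson atMost_iff less_imp_le)
  then have "(\<Union>y\<in>{..x}. {..f y}) = UNIV"
    by blast
  then have "|UNIV :: 'a ordinal set| \<le>o |UNIV :: 'a set|"
    using card_of_UNION_ordLeq_infinite[of "UNIV :: 'a set" "{..x}" "\<lambda>y. {..f y}"]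
    by (simp add: card_of_atMost_ordinal infinite_UNIV)
  then obtain g :: "'a ordinal \<Rightarrow> 'a" where "inj g"
    by (auto simp: card_of_ordLeq[symmetric])
  with no_inj_ordinal show False by blast
qed

lemma no_max_ordinal: "\<exists>y. x < (y :: 'a::infinite ordinal)"
proof (rule ccontr)
  assume "\<nexists>y. x < y"
  then have "{..x} = UNIV"
    by (auto simp: not_less)
  then have "|UNIV :: 'a ordinal set| \<le>o |UNIV :: 'a set|"
    using card_of_atMost_ordinal[of x] by simp
  then obtain g :: "'a ordinal \<Rightarrow> 'a" where "inj g"
    by (auto simp: card_of_ordLeq[symmetric])
  with no_inj_ordinal show False by blast
qed

section \<open>Ordinal arithmetic\<close>

lemma zero_le_ordinal [simp]: "0 \<le> (x :: 'a ordinal)"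
proof -
  have x: "x = abs_ordinal (rep_ordinal x)"
    by (simp add: Quotient_abs_rep[OF Quotient_ordinal])
  have "(rep_ordinal x, {}) \<notin> ordLess"
    by (subst ordLess_iff_ordIso_Restr[OF _ Well_order_rep_ordinal]) simp_all
  then have "\<not> x < 0"
    by (subst x, unfold zero_ordinal_def, subst abs_ordinal_less_iff) (simp_all add: Well_order_rep_ordinal)
  then show ?thesis by simp
qed

lemma le_zero_ordinal [simp]: "(x :: 'a ordinal) \<le> 0 \<longleftrightarrow> x = 0"
  using zero_le_ordinal[of x] by (auto intro: antisym)

lemma not_less_zero_ordinal [simp]: "\<not> (x :: 'a ordinal) < 0"
  by (simp add: not_less)

lemma zero_less_ordinal [simp]: "0 < (x :: 'a ordinal) \<longleftrightarrow> x \<noteq> 0"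
  using le_less[of 0 x] by auto

lemma less_osuc: "x < osuc (x :: 'a::infinite ordinal)"
  unfolding osuc_def using no_max_ordinal by (rule LeastI_ex)

lemma less_osuc_iff: "x < osuc y \<longleftrightarrow> x \<le> (y :: 'a::infinite ordinal)"
proof
  assume "x < osuc y"
  then show "x \<le> y"
    unfolding osuc_def using not_less_Least by force
qed (use less_osuc[of y] in auto)

lemma osuc_le_iff: "osuc x \<le> y \<longleftrightarrow> x < (y :: 'a::infinite ordinal)"
  using less_osuc_iff[of y x] by (metis not_le)

lemma osuc_less_osuc_iff [simp]: "osuc x < osuc y \<longleftrightarrow> x < (y :: 'a::infinite ordinal)"
  by (metis less_osuc_iff osuc_le_iff)

lemma osuc_neq_zero [simp]: "osuc x \<noteq> (0 :: 'a::infinite ordinal)"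
  using less_osuc[of x] by auto

lemma ord_of_nat_less_iff [simp]: "(ord_of_nat m :: 'a::infinite ordinal) < ord_of_nat n \<longleftrightarrow> m < n"
proof (induction n arbitrary: m)
  case 0
  then show ?case by simp
next
  case (Suc n)
  then show ?case by (cases m) simp_all
qed

lemma ord_of_nat_le_iff [simp]: "(ord_of_nat m :: 'a::infinite ordinal) \<le> ord_of_nat n \<longleftrightarrow> m \<le> n"
  by (metis not_le ord_of_nat_less_iff)

lemma ord_of_nat_eq_iff [simp]: "(ord_of_nat m :: 'a::infinite ordinal) = ord_of_nat n \<longleftrightarrow> m = n"
  by (metis order_eq_iff ord_of_nat_le_iff)

lemma less_ord_of_natD: "x < ord_of_nat n \<Longrightarrow> \<exists>m<n. (x :: 'a::infinite ordinal) = ord_of_nat m"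
proof (induction n)
  case (Suc n)
  then have "x \<le> ord_of_nat n" by (simp add: less_osuc_iff)
  with Suc.IH show ?case by (metis le_less lessI less_SucI)
qed simp

lemma oadd_upper_ex:
  "\<exists>\<gamma>. \<alpha> \<le> \<gamma> \<and> (\<forall>\<beta>'\<in>{..<\<beta> :: 'a::infinite ordinal}. oadd \<alpha> \<beta>' < \<gamma>)"
proof -
  obtain \<gamma> where "\<forall>\<beta>'<\<beta>. oadd \<alpha> \<beta>' < \<gamma>"
    using bounded_ordinal_image[of \<beta> "oadd \<alpha>"] by (elim exE)
  then show ?thesis
    by (intro exI[of _ "max \<alpha> \<gamma>"]) (auto simp: less_max_iff_disj)
qed

context
  fixes \<alpha> \<beta> \<gamma> :: "'a::infinite ordinal"
begin

lemma oadd_ge_left: "\<alpha> \<le> oadd \<alpha> \<beta>"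
  by (subst oadd.simps) (rule LeastI2_ex[OF oadd_upper_ex], simp)

lemma oadd_strict_mono: "\<beta> < \<gamma> \<Longrightarrow> oadd \<alpha> \<beta> < oadd \<alpha> \<gamma>"
  by (subst (2) oadd.simps) (rule LeastI2_ex[OF oadd_upper_ex], simp)

lemma oadd_le: "\<alpha> \<le> \<gamma> \<Longrightarrow> (\<And>\<beta>'. \<beta>' < \<beta> \<Longrightarrow> oadd \<alpha> \<beta>' < \<gamma>) \<Longrightarrow> oadd \<alpha> \<beta> \<le> \<gamma>"
  by (subst oadd.simps) (rule Least_le, simp)

end

lemma oadd_less_iff [simp]: "oadd \<alpha> \<beta> < oadd \<alpha> \<gamma> \<longleftrightarrow> \<beta> < (\<gamma> :: 'a::infinite ordinal)"
  by (metis oadd_strict_mono less_asym linorder_neqE)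

lemma oadd_le_iff [simp]: "oadd \<alpha> \<beta> \<le> oadd \<alpha> \<gamma> \<longleftrightarrow> \<beta> \<le> (\<gamma> :: 'a::infinite ordinal)"
  by (metis oadd_less_iff not_le)

lemma oadd_zero [simp]: "oadd \<alpha> 0 = (\<alpha> :: 'a::infinite ordinal)"
  by (rule antisym[OF oadd_le oadd_ge_left]) simp_all

lemma oadd_osuc: "oadd \<alpha> (osuc \<beta>) = osuc (oadd \<alpha> (\<beta> :: 'a::infinite ordinal))"
proof (rule antisym)
  show "oadd \<alpha> (osuc \<beta>) \<le> osuc (oadd \<alpha> \<beta>)"
    by (rule oadd_le) (simp_all add: less_osuc_iff oadd_ge_left less_imp_le)
  show "osuc (oadd \<alpha> \<beta>) \<le> oadd \<alpha> (osuc \<beta>)"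
    by (simp add: osuc_le_iff less_osuc)
qed

text \<open>A strictly increasing map on a well-order never goes below its argument: the least
  descent would itself be mapped to a smaller descent.\<close>

lemma oadd_ge_right: "\<beta> \<le> oadd \<alpha> (\<beta> :: 'a::infinite ordinal)"
proof (induction \<beta> rule: less_induct)
  case (less \<beta>)
  show ?case
  proof (rule ccontr)
    assume "\<not> \<beta> \<le> oadd \<alpha> \<beta>"
    then have *: "oadd \<alpha> \<beta> < \<beta>" by simp
    from less[OF *] oadd_strict_mono[OF *, of \<alpha>] show False by simp
  qed
qed

text \<open>Left subtraction: the least \<delta> that reaches \<beta> cannot overshoot, since all
  smaller values of the sum stay below \<beta> and \<open>oadd\<close> is the least bound.\<close>

lemma oadd_diff_ex:
  assumes "\<alpha> \<le> (\<beta> :: 'a::infinite ordinal)"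
  obtains \<delta> where "\<beta> = oadd \<alpha> \<delta>"
proof -
  define \<delta> where "\<delta> = (LEAST \<delta>. \<beta> \<le> oadd \<alpha> \<delta>)"
  have "\<beta> \<le> oadd \<alpha> \<delta>"
    unfolding \<delta>_def by (rule LeastI[of _ \<beta>]) (rule oadd_ge_right)
  moreover have "oadd \<alpha> \<delta> \<le> \<beta>"
    by (rule oadd_le) (use assms not_less_Least in \<open>force simp: \<delta>_def\<close>)+
  ultimately show thesis using that by (meson antisym)
qed

lemma oadd_mono_left: "\<alpha> \<le> \<beta> \<Longrightarrow> oadd \<alpha> \<delta> \<le> oadd \<beta> (\<delta> :: 'a::infinite ordinal)"
proof (induction \<delta> rule: less_induct)
  case (less \<delta>)
  show ?case
  proof (rule oadd_le)
    show "\<alpha> \<le> oadd \<beta> \<delta>" using less.prems oadd_ge_left order_trans by blast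
    show "oadd \<alpha> \<delta>' < oadd \<beta> \<delta>" if "\<delta>' < \<delta>" for \<delta>'
      using less.IH[OF that less.prems] oadd_strict_mono[OF that] by (rule le_less_trans)
  qed
qed

lemma omul_upper_ex:
  "\<exists>\<gamma>. \<forall>\<beta>'\<in>{..<\<beta> :: 'a::infinite ordinal}. oadd (omul \<alpha> \<beta>') \<alpha> \<le> \<gamma>"
proof -
  obtain \<gamma> where "\<forall>\<beta>'<\<beta>. oadd (omul \<alpha> \<beta>') \<alpha> < \<gamma>"
    using bounded_ordinal_image[of \<beta> "\<lambda>\<beta>'. oadd (omul \<alpha> \<beta>') \<alpha>"] by (elim exE)
  then show ?thesis by (intro exI[of _ \<gamma>]) (simp add: less_imp_le)
qed

lemma omul_ge: "\<beta> < \<gamma> \<Longrightarrow> oadd (omul \<alpha> \<beta>) \<alpha> \<le> omul \<alpha> (\<gamma> :: 'a::infinite ordinal)"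
  by (subst (2) omul.simps) (rule LeastI2_ex[OF omul_upper_ex], simp)

lemma omul_le:
  "(\<And>\<beta>'. \<beta>' < \<beta> \<Longrightarrow> oadd (omul \<alpha> \<beta>') \<alpha> \<le> \<gamma>) \<Longrightarrow> omul \<alpha> \<beta> \<le> (\<gamma> :: 'a::infinite ordinal)"
  by (subst omul.simps) (rule Least_le, simp)

lemma omul_zero [simp]: "omul \<alpha> 0 = (0 :: 'a::infinite ordinal)"
  using omul_le[of 0 \<alpha> 0] by simp

lemma omul_mono: "\<beta> \<le> \<gamma> \<Longrightarrow> omul \<alpha> \<beta> \<le> omul \<alpha> (\<gamma> :: 'a::infinite ordinal)"
  by (rule omul_le) (rule omul_ge, simp)

lemma omul_osuc: "omul \<alpha> (osuc \<beta>) = oadd (omul \<alpha> \<beta>) (\<alpha> :: 'a::infinite ordinal)"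
proof (rule antisym)
  show "omul \<alpha> (osuc \<beta>) \<le> oadd (omul \<alpha> \<beta>) \<alpha>"
    by (rule omul_le) (simp add: less_osuc_iff oadd_mono_left omul_mono)
  show "oadd (omul \<alpha> \<beta>) \<alpha> \<le> omul \<alpha> (osuc \<beta>)"
    by (rule omul_ge) (rule less_osuc)
qed

lemma omul_one [simp]: "omul (ord_of_nat 1) (ord_of_nat n) = (ord_of_nat n :: 'a::infinite ordinal)"
  by (induction n) (simp_all add: omul_osuc oadd_osuc)

section \<open>Cantor normal forms\<close>

text \<open>Otherwise every ordinal is finite, so the type of ordinals is countable and embeds into
  the infinite type \<open>'a\<close>.\<close>

lemma omega_upper_ex: "\<exists>\<alpha>. \<forall>n. ord_of_nat n < (\<alpha> :: 'a::infinite ordinal)"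
proof (rule ccontr)
  assume "\<not> ?thesis"
  then have "\<exists>n. \<alpha> \<le> ord_of_nat n" for \<alpha> :: "'a ordinal"
    by (auto simp: not_less)
  then have "\<exists>n. \<alpha> = ord_of_nat n" for \<alpha> :: "'a ordinal"
    by (fastforce simp: le_less dest: less_ord_of_natD)
  then obtain k where k: "\<alpha> = ord_of_nat (k \<alpha>)" for \<alpha> :: "'a ordinal"
    by metis
  obtain h :: "nat \<Rightarrow> 'a" where "inj h"
    using infinite_countable_subset[OF infinite_UNIV] by auto
  moreover have "inj k"
    by (metis injI k)
  ultimately show False
    using no_inj_ordinal inj_compose by blast
qed

lemma ord_of_nat_less_omega [simp]: "ord_of_nat n < (omega :: 'a::infinite ordinal)"
  unfolding omega_def by (rule LeastI2_ex[OF omega_upper_ex]) simp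

lemma omul_ord_of_nat_ge: "n > 0 \<Longrightarrow> \<alpha> \<le> omul \<alpha> (ord_of_nat n :: 'a::infinite ordinal)"
  by (cases n) (simp_all add: omul_osuc oadd_ge_right)

lemma less_omega_iff: "x < omega \<longleftrightarrow> (\<exists>n. x = (ord_of_nat n :: 'a::infinite ordinal))"
proof
  assume "x < omega"
  then obtain n where "x \<le> ord_of_nat n"
    using not_less_Least[of x "\<lambda>\<alpha>. \<forall>n. ord_of_nat n < \<alpha>"] by (auto simp: omega_def not_less)
  then show "\<exists>n. x = ord_of_nat n"
    by (auto simp: le_less dest: less_ord_of_natD)
qed auto

lemma oadd_zero_left [simp]: "oadd 0 x = (x :: 'a::infinite ordinal)"
proof (induction x rule: less_induct)
  case (less x)
  show ?case
    by (rule antisym[OF oadd_le oadd_ge_right]) (simp_all add: less)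
qed

section \<open>Powers of \<omega> and leading terms\<close>

lemma omega_pow_upper_ex:
  "\<exists>\<gamma>. 0 < \<gamma> \<and> (\<forall>\<beta>'\<in>{..<\<beta> :: 'a::infinite ordinal}. omul (omega_pow \<beta>') omega \<le> \<gamma>)"
proof -
  obtain \<gamma> where "\<forall>\<beta>'<\<beta>. omul (omega_pow \<beta>') omega < \<gamma>"
    using bounded_ordinal_image[of \<beta> "\<lambda>\<beta>'. omul (omega_pow \<beta>') omega"] by (elim exE)
  then show ?thesis
    by (intro exI[of _ "max (osuc 0) \<gamma>"]) (auto simp: less_max_iff_disj le_max_iff_disj less_imp_le)
qed

lemma omega_pow_pos: "0 < omega_pow (\<beta> :: 'a::infinite ordinal)"
  by (subst omega_pow.simps) (rule LeastI2_ex[OF omega_pow_upper_ex], simp)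

lemma omega_pow_ge: "\<beta> < \<gamma> \<Longrightarrow> omul (omega_pow \<beta>) omega \<le> omega_pow (\<gamma> :: 'a::infinite ordinal)"
  by (subst (2) omega_pow.simps) (rule LeastI2_ex[OF omega_pow_upper_ex], simp)

lemma omega_pow_le:
  assumes "0 < \<gamma>" "\<And>\<beta>'. \<beta>' < \<beta> \<Longrightarrow> omul (omega_pow \<beta>') omega \<le> \<gamma>"
  shows "omega_pow \<beta> \<le> (\<gamma> :: 'a::infinite ordinal)"
  by (subst omega_pow.simps) (rule Least_le, use assms in simp)

lemma omega_pow_zero [simp]: "omega_pow 0 = (ord_of_nat 1 :: 'a::infinite ordinal)"
  by (rule antisym[OF omega_pow_le]) (use omega_pow_pos[of 0] in \<open>simp_all add: osuc_le_iff\<close>)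

text \<open>Replacing \<open>x\<close> by one more copy of \<open>omega_pow \<beta>\<close> gives
  the next finite multiple, which is still within \<open>omul (omega_pow \<beta>) omega\<close>. So
  a sum with leading exponent \<beta> never reaches a higher power.\<close>

lemma omega_pow_mult_less:
  assumes "\<beta> < \<gamma>" "x < omega_pow \<beta>"
  shows "oadd (omul (omega_pow \<beta>) (ord_of_nat n)) x < omega_pow (\<gamma> :: 'a::infinite ordinal)"
proof -
  have "oadd (omul (omega_pow \<beta>) (ord_of_nat n)) x < oadd (omul (omega_pow \<beta>) (ord_of_nat n)) (omega_pow \<beta>)"
    using assms(2) by simp
  also have "\<dots> \<le> omul (omega_pow \<beta>) omega"
    by (rule omul_ge) simp
  also have "\<dots> \<le> omega_pow \<gamma>"
    using assms(1) by (rule omega_pow_ge)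
  finally show ?thesis .
qed

lemma omega_pow_strict_mono: "\<beta> < \<gamma> \<Longrightarrow> omega_pow \<beta> < omega_pow (\<gamma> :: 'a::infinite ordinal)"
  using omega_pow_mult_less[of \<beta> \<gamma> 0 1] omega_pow_pos[of \<beta>] by (simp add: omul_osuc)

lemma omega_pow_less_iff: "omega_pow \<beta> < omega_pow \<gamma> \<longleftrightarrow> \<beta> < (\<gamma> :: 'a::infinite ordinal)"
  by (metis omega_pow_strict_mono less_asym linorder_neqE)

lemma omega_pow_ge_self: "\<beta> \<le> omega_pow (\<beta> :: 'a::infinite ordinal)"
proof (induction \<beta> rule: less_induct)
  case (less \<beta>)
  show ?case
  proof (rule ccontr)
    assume "\<not> \<beta> \<le> omega_pow \<beta>"
    then have *: "omega_pow \<beta> < \<beta>" by simp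
    from less[OF *] omega_pow_strict_mono[OF *] show False by simp
  qed
qed

lemma leading_term_ex:
  assumes "\<alpha> \<noteq> (0 :: 'a::infinite ordinal)"
  obtains \<zeta> n \<delta> where "n > 0" "\<delta> < omega_pow \<zeta>" "\<alpha> = oadd (omul (omega_pow \<zeta>) (ord_of_nat n)) \<delta>"
proof -
  define \<eta> where "\<eta> = (LEAST \<eta>. \<alpha> < omega_pow \<eta>)"
  have "\<exists>\<eta>. \<alpha> < omega_pow \<eta>"
    using omega_pow_ge_self no_max_ordinal by (metis less_le_trans)
  then have \<eta>: "\<alpha> < omega_pow \<eta>"
    unfolding \<eta>_def by (rule LeastI_ex)
  \<comment> \<open>As a least bound, \<open>omega_pow \<eta>\<close> would be at most \<alpha> if
    every \<open>omul (omega_pow \<zeta>) omega\<close> with \<zeta> < \<eta> were. This covers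
    successor and limit \<eta> together; \<alpha> \<noteq> 0 supplies the positivity clause.\<close>
  then obtain \<zeta> where \<zeta>: "\<zeta> < \<eta>" "\<alpha> < omul (omega_pow \<zeta>) omega"
    using omega_pow_le[of \<alpha> \<eta>] assms by (metis leD not_less zero_less_ordinal)
  have ge: "omega_pow \<zeta> \<le> \<alpha>"
    using not_less_Least[OF \<zeta>(1)[unfolded \<eta>_def]] by simp
  have "\<exists>n. \<alpha> < omul (omega_pow \<zeta>) (ord_of_nat (Suc n))"
  proof (rule ccontr)
    assume "\<not> ?thesis"
    then have "omul (omega_pow \<zeta>) omega \<le> \<alpha>"
      by (intro omul_le) (auto simp: less_omega_iff omul_osuc not_less)
    with \<zeta>(2) show False by simp
  qed
  \<comment> \<open>The least \<open>n\<close> whose successor multiple exceeds \<alpha> is the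
    leading coefficient, and what \<alpha> has beyond the \<open>n\<close>-th multiple is the
    remainder.\<close>
  then obtain n where n: "\<alpha> < omul (omega_pow \<zeta>) (ord_of_nat (Suc n))"
    and least: "\<And>m. m < n \<Longrightarrow> \<not> \<alpha> < omul (omega_pow \<zeta>) (ord_of_nat (Suc m))"
    using exists_least_iff[of "\<lambda>n. \<alpha> < omul (omega_pow \<zeta>) (ord_of_nat (Suc n))"] by blast
  from n ge have n0: "n > 0"
    by (cases n) (simp_all add: omul_osuc)
  then have "omul (omega_pow \<zeta>) (ord_of_nat n) \<le> \<alpha>"
    using least[of "n - 1"] by simp
  then obtain \<delta> where \<delta>: "\<alpha> = oadd (omul (omega_pow \<zeta>) (ord_of_nat n)) \<delta>"
    by (rule oadd_diff_ex)
  with n have "\<delta> < omega_pow \<zeta>"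
    by (simp add: omul_osuc)
  with n0 \<delta> show thesis using that by blast
qed

text \<open>Splits off the top term without further reference to the sorted list. The exponent
  \<zeta> only has to bound the support, so two functions can be split at a common \<zeta> even if
  one of them vanishes there.\<close>

lemma cnf_sum_lead:
  fixes c :: "'a::infinite ordinal \<Rightarrow> nat"
  assumes fin: "finite (supp c)" and bound: "\<And>\<eta>. \<zeta> < \<eta> \<Longrightarrow> c \<eta> = 0"
  shows "cnf_sum c = oadd (omul (omega_pow \<zeta>) (ord_of_nat (c \<zeta>))) (cnf_sum (c(\<zeta> := 0)))"
proof (cases "c \<zeta> = 0")
  case True
  then have "c(\<zeta> := 0) = c" by auto
  with True show ?thesis by simp
next
  case False
  define A where "A = supp (c(\<zeta> := 0))"
  have A: "supp c = insert \<zeta> A" and less: "\<forall>\<eta>\<in>A. \<eta> < \<zeta>"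
    using False bound by (auto simp: A_def supp_def not_less le_less intro: ccontr)
  have finA: "finite A" using fin A by simp
  have "sorted_list_of_set (insert \<zeta> A) = sorted_list_of_set A @ [\<zeta>]"
    using sorted_list_of_set.idem_if_sorted_distinct[of "sorted_list_of_set A @ [\<zeta>]"] less finA
    by (force simp: sorted_append less_imp_le)
  moreover have "foldr (\<lambda>\<zeta>. oadd (omul (omega_pow \<zeta>) (ord_of_nat (c \<zeta>)))) (rev (sorted_list_of_set A)) 0
      = cnf_sum (c(\<zeta> := 0))"
    unfolding cnf_sum_def A_def[symmetric]
    by (rule foldr_cong) (use less finA in auto)
  ultimately show ?thesis
    unfolding cnf_sum_def[of c] A by simp
qed

section \<open>Comparison of Cantor sums, existence and uniqueness of normal forms\<close>

lemma cnf_sum_zero [simp]: "cnf_sum (\<lambda>_. 0) = 0"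
  by (simp add: cnf_sum_def supp_def)

lemma finite_supp_update [simp]: "finite (supp (c(\<zeta> := x))) \<longleftrightarrow> finite (supp c)"
proof -
  have "supp (c(\<zeta> := x)) \<subseteq> insert \<zeta> (supp c)" "supp c \<subseteq> insert \<zeta> (supp (c(\<zeta> := x)))"
    by (auto simp: supp_def)
  then show ?thesis by (meson finite_insert finite_subset)
qed

lemma card_supp_update_zero:
  "finite (supp c) \<Longrightarrow> c \<zeta> \<noteq> 0 \<Longrightarrow> card (supp (c(\<zeta> := 0))) < card (supp c)"
  by (rule psubset_card_mono) (auto simp: supp_def)

lemma supp_max_ex:
  fixes c :: "'a::linorder \<Rightarrow> 'b::zero"
  assumes "finite (supp c)" "c \<noteq> (\<lambda>_. 0)"
  obtains \<mu> where "c \<mu> \<noteq> 0" "\<And>\<eta>. \<mu> < \<eta> \<Longrightarrow> c \<eta> = 0"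
proof -
  have ne: "supp c \<noteq> {}" using assms(2) by (auto simp: supp_def)
  have "c (Max (supp c)) \<noteq> 0"
    using Max_in[OF assms(1) ne] by (simp add: supp_def)
  moreover have "c \<eta> = 0" if "Max (supp c) < \<eta>" for \<eta>
  proof (rule ccontr)
    assume "c \<eta> \<noteq> 0"
    then have "\<eta> \<le> Max (supp c)"
      using assms(1) by (intro Max_ge) (simp_all add: supp_def)
    with that show False by simp
  qed
  ultimately show thesis using that by blast
qed

text \<open>Induction on the size of the support with \<zeta> general: once the top exponent \<mu>
  is removed, the rest is below \<open>omega_pow \<mu>\<close>, and
  \<open>omega_pow_mult_less\<close> takes the whole sum below
  \<open>omega_pow \<zeta>\<close>.\<close>

lemma cnf_sum_less_omega_pow:
  fixes c :: "'a::infinite ordinal \<Rightarrow> nat"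
  assumes "finite (supp c)" "\<And>\<eta>. \<zeta> \<le> \<eta> \<Longrightarrow> c \<eta> = 0"
  shows "cnf_sum c < omega_pow \<zeta>"
  using assms
proof (induction "card (supp c)" arbitrary: c \<zeta> rule: less_induct)
  case less
  show ?case
  proof (cases "c = (\<lambda>_. 0)")
    case True
    then show ?thesis using omega_pow_pos by simp
  next
    case False
    then obtain \<mu> where \<mu>: "c \<mu> \<noteq> 0" "\<And>\<eta>. \<mu> < \<eta> \<Longrightarrow> c \<eta> = 0"
      using supp_max_ex less.prems(1) by blast
    have "\<mu> < \<zeta>" using less.prems(2)[of \<mu>] \<mu>(1) by (meson not_less)
    moreover have "cnf_sum (c(\<mu> := 0)) < omega_pow \<mu>"
      by (rule less.hyps) (use \<mu> less.prems in \<open>auto simp: card_supp_update_zero\<close>)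
    ultimately show ?thesis
      using cnf_sum_lead[of c \<mu>] less.prems(1) \<mu>(2) omega_pow_mult_less by metis
  qed
qed

text \<open>The largest exponent at which the functions differ decides, as in the comparison of
  polynomials by growth.\<close>

definition lex_less :: "('a::linorder \<Rightarrow> nat) \<Rightarrow> ('a \<Rightarrow> nat) \<Rightarrow> bool" where
  "lex_less c d \<longleftrightarrow> (\<exists>\<zeta>. c \<zeta> < d \<zeta> \<and> (\<forall>\<eta>>\<zeta>. c \<eta> = d \<eta>))"

lemma lex_less_total:
  assumes "finite (supp c)" "finite (supp d)" "c \<noteq> d"
  shows "lex_less c d \<or> lex_less d c"
proof -
  \<comment> \<open>The difference is taken in \<open>int\<close>: truncated subtraction would lose
    the positions where \<open>d\<close> is larger.\<close>
  define e where "e \<zeta> = int (c \<zeta>) - int (d \<zeta>)" for \<zeta>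
  have "supp e \<subseteq> supp c \<union> supp d"
    by (auto simp: supp_def e_def)
  then have "finite (supp e)"
    using assms by (meson finite_Un finite_subset)
  moreover have "e \<noteq> (\<lambda>_. 0)"
    using assms(3) by (auto simp: e_def fun_eq_iff)
  ultimately obtain \<mu> where "e \<mu> \<noteq> 0" "\<And>\<eta>. \<mu> < \<eta> \<Longrightarrow> e \<eta> = 0"
    using supp_max_ex by blast
  then show ?thesis
    unfolding lex_less_def e_def
    by (metis eq_iff_diff_eq_0 linorder_neqE_nat of_nat_eq_iff)
qed

text \<open>If \<open>c\<close> has an exponent above the deciding \<zeta>, both sums share their
  top term, and it can be removed. Otherwise \<zeta> is at the top, and the lower terms of
  \<open>c\<close> amount to less than one further copy of \<open>omega_pow \<zeta>\<close>, which
  \<open>d\<close> has to spare.\<close>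

lemma cnf_sum_strict_mono:
  fixes c d :: "'a::infinite ordinal \<Rightarrow> nat"
  assumes "finite (supp c)" "finite (supp d)" "lex_less c d"
  shows "cnf_sum c < cnf_sum d"
  using assms
proof (induction "card (supp c)" arbitrary: c d rule: less_induct)
  case less
  from less.prems(3) obtain \<zeta> where \<zeta>: "c \<zeta> < d \<zeta>" "\<And>\<eta>. \<zeta> < \<eta> \<Longrightarrow> c \<eta> = d \<eta>"
    by (auto simp: lex_less_def)
  show ?case
  proof (cases "\<exists>\<eta>>\<zeta>. c \<eta> \<noteq> 0")
    case True
    then obtain \<eta> where \<eta>: "\<zeta> < \<eta>" "c \<eta> \<noteq> 0" by blast
    then have "c \<noteq> (\<lambda>_. 0)" by auto
    then obtain \<mu> where \<mu>: "c \<mu> \<noteq> 0" "\<And>\<eta>. \<mu> < \<eta> \<Longrightarrow> c \<eta> = 0"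
      using supp_max_ex less.prems(1) by blast
    have "\<zeta> < \<mu>" using \<eta> \<mu>(2)[of \<eta>] by (meson less_le_trans not_less)
    then have d: "d \<mu> = c \<mu>" and \<mu>d: "\<And>\<eta>. \<mu> < \<eta> \<Longrightarrow> d \<eta> = 0"
      using \<zeta>(2) \<mu>(2) by (fastforce dest: less_trans)+
    have "lex_less (c(\<mu> := 0)) (d(\<mu> := 0))"
      unfolding lex_less_def using \<zeta> \<open>\<zeta> < \<mu>\<close> by (intro exI[of _ \<zeta>]) auto
    then have "cnf_sum (c(\<mu> := 0)) < cnf_sum (d(\<mu> := 0))"
      using less.prems \<mu>(1) by (intro less.hyps) (auto simp: card_supp_update_zero)
    then show ?thesis
      using cnf_sum_lead[of c \<mu>] cnf_sum_lead[of d \<mu>] less.prems \<mu>(2) \<mu>d d by simp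
  next
    case False
    then have c0: "\<And>\<eta>. \<zeta> < \<eta> \<Longrightarrow> c \<eta> = 0" and d0: "\<And>\<eta>. \<zeta> < \<eta> \<Longrightarrow> d \<eta> = 0"
      using \<zeta>(2) by auto
    have "cnf_sum (c(\<zeta> := 0)) < omega_pow \<zeta>"
      by (rule cnf_sum_less_omega_pow) (use less.prems c0 in auto)
    then have "cnf_sum c < oadd (omul (omega_pow \<zeta>) (ord_of_nat (c \<zeta>))) (omega_pow \<zeta>)"
      using cnf_sum_lead[of c \<zeta>] less.prems(1) c0 by simp
    also have "\<dots> \<le> omul (omega_pow \<zeta>) (ord_of_nat (d \<zeta>))"
      using \<zeta>(1) by (intro omul_ge) simp
    also have "\<dots> \<le> cnf_sum d"
      using cnf_sum_lead[of d \<zeta>] less.prems(2) d0 by (simp add: oadd_ge_left)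
    finally show ?thesis .
  qed
qed

lemma cnf_sum_less_iff:
  fixes c d :: "'a::infinite ordinal \<Rightarrow> nat"
  assumes "finite (supp c)" "finite (supp d)"
  shows "cnf_sum c < cnf_sum d \<longleftrightarrow> lex_less c d"
  using cnf_sum_strict_mono[OF assms] cnf_sum_strict_mono[OF assms(2,1)] lex_less_total[OF assms]
  by (metis less_asym less_irrefl)

lemma cnf_sum_eq_iff:
  fixes c d :: "'a::infinite ordinal \<Rightarrow> nat"
  assumes "finite (supp c)" "finite (supp d)"
  shows "cnf_sum c = cnf_sum d \<longleftrightarrow> c = d"
  using cnf_sum_strict_mono[OF assms] cnf_sum_strict_mono[OF assms(2,1)] lex_less_total[OF assms]
  by (metis less_irrefl)

lemma cnf_ex: "\<exists>c. finite (supp c) \<and> cnf_sum c = (\<alpha> :: 'a::infinite ordinal)"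
proof (induction \<alpha> rule: less_induct)
  case (less \<alpha>)
  show ?case
  proof (cases "\<alpha> = 0")
    case True
    then show ?thesis by (intro exI[of _ "\<lambda>_. 0"]) (simp add: supp_def)
  next
    case False
    then obtain \<zeta> n \<delta> where *: "n > 0" "\<delta> < omega_pow \<zeta>" 
      and \<alpha>: "\<alpha> = oadd (omul (omega_pow \<zeta>) (ord_of_nat n)) \<delta>"
      by (rule leading_term_ex)
    have "omega_pow \<zeta> \<le> omul (omega_pow \<zeta>) (ord_of_nat n)"
      using *(1) by (rule omul_ord_of_nat_ge)
    also have "\<dots> \<le> \<alpha>" unfolding \<alpha> by (rule oadd_ge_left)
    finally have "\<delta> < \<alpha>" using *(2) by simp
    with less obtain d where d: "finite (supp d)" "cnf_sum d = \<delta>" by blast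
    \<comment> \<open>An exponent of \<open>d\<close> at or above \<zeta> would make \<delta> at
      least \<open>omega_pow \<zeta>\<close>. Hence setting the coefficient \<open>n\<close> at
      \<zeta> prepends a term and overwrites nothing.\<close>
    have d0: "d \<eta> = 0" if "\<zeta> \<le> \<eta>" for \<eta>
    proof (rule ccontr)
      assume "d \<eta> \<noteq> 0"
      then have "d \<noteq> (\<lambda>_. 0)" by auto
      then obtain \<mu> where \<mu>: "d \<mu> \<noteq> 0" "\<And>\<eta>. \<mu> < \<eta> \<Longrightarrow> d \<eta> = 0"
        using supp_max_ex d(1) by blast
      then have "\<zeta> \<le> \<mu>" using \<open>d \<eta> \<noteq> 0\<close> that by (meson not_less order_trans)
      then have "omega_pow \<zeta> \<le> omega_pow \<mu>" by (metis omega_pow_less_iff not_less)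
      also have "\<dots> \<le> omul (omega_pow \<mu>) (ord_of_nat (d \<mu>))"
        using \<mu>(1) by (intro omul_ord_of_nat_ge) simp
      also have "\<dots> \<le> \<delta>"
        using cnf_sum_lead[of d \<mu>] d \<mu>(2) by (metis oadd_ge_left)
      finally show False using *(2) by simp
    qed
    have "finite (supp (d(\<zeta> := n)))" using d(1) by simp
    moreover have "cnf_sum (d(\<zeta> := n)) = \<alpha>"
      using d d0[of \<zeta>] by (subst cnf_sum_lead[of _ \<zeta>]) (auto simp: d0 \<alpha> fun_upd_idem)
    ultimately show ?thesis by blast
  qed
qed

lemma cnf_cnf_sum: "finite (supp c) \<Longrightarrow> cnf (cnf_sum c) = (c :: 'a::infinite ordinal \<Rightarrow> nat)"
  unfolding cnf_def by (rule the_equality) (auto simp: cnf_sum_eq_iff)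

lemma finite_supp_cnf [simp]: "finite (supp (cnf (\<alpha> :: 'a::infinite ordinal)))"
  using cnf_ex[of \<alpha>] cnf_cnf_sum by metis

lemma cnf_sum_cnf [simp]: "cnf_sum (cnf \<alpha>) = (\<alpha> :: 'a::infinite ordinal)"
  using cnf_ex[of \<alpha>] cnf_cnf_sum by metis

lemma less_ordinal_iff_lex_less: "\<alpha> < \<beta> \<longleftrightarrow> lex_less (cnf \<alpha>) (cnf (\<beta> :: 'a::infinite ordinal))"
  using cnf_sum_less_iff[of "cnf \<alpha>" "cnf \<beta>"] by simp

lemma cnf_ord_of_nat: "cnf (ord_of_nat n :: 'a::infinite ordinal) = (\<lambda>_. 0)(0 := n)"
proof -
  have "finite (supp ((\<lambda>_. 0)(0 := n) :: 'a ordinal \<Rightarrow> nat))"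
    by (simp add: supp_def)
  moreover have "cnf_sum ((\<lambda>_. 0)(0 := n)) = (ord_of_nat n :: 'a ordinal)"
    using calculation by (subst cnf_sum_lead[of _ 0]) (auto simp: fun_upd_idem simp flip: One_nat_def)
  ultimately show ?thesis
    using cnf_cnf_sum by metis
qed

section \<open>The ring \<open>\<int>\<^sub>\<infinity>\<close>\<close>

lemma finite_supp_add: "finite (supp c) \<Longrightarrow> finite (supp d) \<Longrightarrow> finite (supp (\<lambda>\<zeta>. c \<zeta> + d \<zeta> :: 'b::monoid_add))"
  by (rule finite_subset[of _ "supp c \<union> supp d"]) (auto simp: supp_def)

lemma cnf_nat_sum: "cnf (nat_sum \<alpha> \<beta>) = (\<lambda>\<zeta>. cnf \<alpha> \<zeta> + cnf (\<beta> :: 'a::infinite ordinal) \<zeta>)"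
  unfolding nat_sum_def by (rule cnf_cnf_sum) (simp add: finite_supp_add)

lemma cnf_zero [simp]: "cnf (0 :: 'a::infinite ordinal) = (\<lambda>_. 0)"
  using cnf_cnf_sum[of "\<lambda>_::'a ordinal. 0 :: nat"] by (simp add: supp_def)

lemma supp_zero [simp]: "supp (\<lambda>_. 0) = {}"
  by (simp add: supp_def)

lemma cnf_eq_iff: "cnf \<alpha> = cnf \<beta> \<longleftrightarrow> \<alpha> = (\<beta> :: 'a::infinite ordinal)"
  by (metis cnf_sum_cnf)

text \<open>The coefficientwise truncated difference is only there to make the natural sum cancellative in
  the sense of the type class.\<close>

instantiation ordinal :: (infinite) ordered_cancel_comm_monoid_add
begin

definition plus_ordinal :: "'a ordinal \<Rightarrow> 'a ordinal \<Rightarrow> 'a ordinal" where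
  "plus_ordinal = nat_sum"

definition minus_ordinal :: "'a ordinal \<Rightarrow> 'a ordinal \<Rightarrow> 'a ordinal" where
  "minus_ordinal \<alpha> \<beta> = cnf_sum (\<lambda>\<zeta>. cnf \<alpha> \<zeta> - cnf \<beta> \<zeta>)"

lemma cnf_add: "cnf (\<alpha> + \<beta>) \<zeta> = cnf \<alpha> \<zeta> + cnf (\<beta> :: 'a ordinal) \<zeta>"
  by (simp add: plus_ordinal_def cnf_nat_sum)

lemma cnf_minus: "cnf (\<alpha> - \<beta>) \<zeta> = cnf \<alpha> \<zeta> - cnf (\<beta> :: 'a ordinal) \<zeta>"
proof -
  have "finite (supp (\<lambda>\<zeta>. cnf \<alpha> \<zeta> - cnf \<beta> \<zeta>))"
    by (rule finite_subset[OF _ finite_supp_cnf[of \<alpha>]]) (auto simp: supp_def)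
  then show ?thesis by (simp add: minus_ordinal_def cnf_cnf_sum)
qed

instance
proof
  fix \<alpha> \<beta> \<gamma> :: "'a ordinal"
  show "\<alpha> + \<beta> + \<gamma> = \<alpha> + (\<beta> + \<gamma>)" "\<alpha> + \<beta> = \<beta> + \<alpha>" "0 + \<alpha> = \<alpha>"
    "\<alpha> + \<beta> - \<alpha> = \<beta>" "\<alpha> - \<beta> - \<gamma> = \<alpha> - (\<beta> + \<gamma>)"
    by (simp_all add: cnf_eq_iff[symmetric] fun_eq_iff cnf_add cnf_minus)
  assume "\<alpha> \<le> \<beta>"
  then consider "\<alpha> = \<beta>" | "\<alpha> < \<beta>" by (auto simp: le_less)
  then show "\<gamma> + \<alpha> \<le> \<gamma> + \<beta>"
  proof cases
    case 2
    then have "\<gamma> + \<alpha> < \<gamma> + \<beta>"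
      using less_ordinal_iff_lex_less[of \<alpha> \<beta>] less_ordinal_iff_lex_less[of "\<gamma> + \<alpha>" "\<gamma> + \<beta>"]
      by (simp add: lex_less_def cnf_add)
    then show ?thesis by simp
  qed simp
qed

end

section \<open>Transport of \<open>Z_ring\<close> to finitely supported functions\<close>

type_synonym 'a zpoly = "'a ordinal \<Rightarrow>\<^sub>0 int"

abbreviation lookup :: "('a \<Rightarrow>\<^sub>0 'b::zero) \<Rightarrow> 'a \<Rightarrow> 'b" where
  "lookup \<equiv> Poly_Mapping.lookup"

lemma finite_supp_lookup [simp]: "finite (supp (lookup p))"
  unfolding supp_def by (rule finite_lookup)

text \<open>Both sides sum over pairs of exponents with the same natural sum; the library sum over
  all pairs is cut down to the two supports.\<close>

lemma lookup_times_convolution: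
  "lookup (p * q) = convolution (lookup p) (lookup (q :: 'a::infinite ordinal \<Rightarrow>\<^sub>0 'b::semiring_0))"
proof
  fix \<theta>
  let ?S = "supp (lookup p) \<times> supp (lookup q)"
  have "lookup (p * q) \<theta> = (\<Sum>(\<zeta>, \<eta>). lookup p \<zeta> * lookup q \<eta> when \<theta> = \<zeta> + \<eta>)"
    by (simp add: times_poly_mapping.rep_eq prod_fun_unfold_prod)
  also have "\<dots> = (\<Sum>(\<zeta>, \<eta>)\<in>?S. lookup p \<zeta> * lookup q \<eta> when \<theta> = \<zeta> + \<eta>)"
    by (rule Sum_any.expand_superset) (auto simp: supp_def)
  also have "\<dots> = convolution (lookup p) (lookup q) \<theta>"
    unfolding convolution_def by (rule sum.mono_neutral_cong_right) (auto simp: plus_ordinal_def)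
  finally show "lookup (p * q) \<theta> = convolution (lookup p) (lookup q) \<theta>" .
qed

definition zpair :: "'a zpoly \<Rightarrow> 'a zpair" where
  "zpair p = of_zcoeff (lookup p)"

lemma finite_supp_nat:
  assumes "finite (supp c)"
  shows "finite (supp (\<lambda>\<zeta>. nat (c \<zeta>)))" "finite (supp (\<lambda>\<zeta>. nat (- c \<zeta>)))"
  by (rule finite_subset[OF _ assms], auto simp: supp_def)+

lemma cnf_of_zcoeff:
  fixes c :: "'a::infinite ordinal \<Rightarrow> int"
  assumes "finite (supp c)"
  shows "cnf (fst (of_zcoeff c)) = (\<lambda>\<zeta>. nat (- c \<zeta>))" "cnf (snd (of_zcoeff c)) = (\<lambda>\<zeta>. nat (c \<zeta>))"
  using finite_supp_nat[OF assms] by (simp_all add: of_zcoeff_def cnf_cnf_sum)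

lemma zcoeff_zpair [simp]: "zcoeff (zpair p) = lookup (p :: 'a::infinite zpoly)"
  by (simp add: fun_eq_iff zcoeff_def zpair_def cnf_of_zcoeff)

lemma zpair_eq_iff [simp]: "zpair p = zpair q \<longleftrightarrow> p = (q :: 'a::infinite zpoly)"
  by (metis zcoeff_zpair poly_mapping_eq_iff)

lemma zpair_in_Z_inf [simp]: "zpair p \<in> (Z_inf :: 'a::infinite zpair set)"
  using cnf_of_zcoeff[of "lookup p"]
  by (cases "zpair p") (auto simp: Z_inf_def zpair_def supp_def)

text \<open>With disjoint supports nothing cancels in the difference of coefficients, so its
  positive and negative parts give back the two coordinates.\<close>

lemma of_zcoeff_zcoeff:
  assumes "a \<in> (Z_inf :: 'a::infinite zpair set)"
  shows "of_zcoeff (zcoeff a) = a"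
proof -
  have disj: "cnf (fst a) \<zeta> = 0 \<or> cnf (snd a) \<zeta> = 0" for \<zeta>
    using assms by (auto simp: Z_inf_def supp_def)
  have "nat (- zcoeff a \<zeta>) = cnf (fst a) \<zeta>" "nat (zcoeff a \<zeta>) = cnf (snd a) \<zeta>" for \<zeta>
    using disj[of \<zeta>] by (auto simp: zcoeff_def)
  then show ?thesis by (simp add: of_zcoeff_def)
qed

lemma Z_inf_eq_range: "(Z_inf :: 'a::infinite zpair set) = range zpair"
proof (intro equalityI subsetI)
  fix a :: "'a zpair"
  assume a: "a \<in> Z_inf"
  have "finite (supp (zcoeff a))"
  proof (rule finite_subset)
    show "supp (zcoeff a) \<subseteq> supp (cnf (fst a)) \<union> supp (cnf (snd a))"
      by (auto simp: supp_def zcoeff_def)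
  qed simp
  then have "zpair (Abs_poly_mapping (zcoeff a)) = a"
    by (simp add: zpair_def supp_def of_zcoeff_zcoeff[OF a])
  then show "a \<in> range zpair" by (metis rangeI)
qed auto

lemma Z_ring_mult [simp]: "zpair p \<otimes>\<^bsub>Z_ring\<^esub> zpair q = zpair (p * q :: 'a::infinite zpoly)"
  by (simp add: Z_ring_def lookup_times_convolution) (simp add: zpair_def lookup_times_convolution)

lemma Z_ring_add [simp]: "zpair p \<oplus>\<^bsub>Z_ring\<^esub> zpair q = zpair (p + q :: 'a::infinite zpoly)"
  by (simp add: Z_ring_def) (simp add: zpair_def plus_poly_mapping.rep_eq)

lemma zneg_zpair [simp]: "zneg (zpair p) = zpair (- p :: 'a::infinite zpoly)"
  by (simp add: zneg_def zpair_def of_zcoeff_def)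

lemma zpair_of_int:
  "zpair (of_int k) = (ord_of_nat (nat (- k)), ord_of_nat (nat k) :: 'a::infinite ordinal)"
proof -
  have "(\<lambda>\<zeta>. nat (lookup (of_int m :: 'a zpoly) \<zeta>)) = cnf (ord_of_nat (nat m))" for m
    by (auto simp: fun_eq_iff lookup_of_int cnf_ord_of_nat)
  from this[of k] this[of "- k"] show ?thesis
    by (simp add: zpair_def of_zcoeff_def)
qed

lemma Z_ring_zero: "\<zero>\<^bsub>Z_ring\<^esub> = zpair (0 :: 'a::infinite zpoly)"
  using zpair_of_int[of 0, where ?'a = 'a] by (simp add: Z_ring_def)

lemma Z_ring_one: "\<one>\<^bsub>Z_ring\<^esub> = zpair (1 :: 'a::infinite zpoly)"
  using zpair_of_int[of 1, where ?'a = 'a] by (simp add: Z_ring_def)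

lemma Z_ring_carrier [simp]: "carrier Z_ring = Z_inf"
  by (simp add: Z_ring_def)

lemma Z_ring_divides [simp]:
  "zpair p divides\<^bsub>Z_ring\<^esub> zpair q \<longleftrightarrow> p dvd (q :: 'a::infinite zpoly)"
  unfolding factor_def by (auto simp: Z_inf_eq_range dvd_def)

lemma Z_pos_of_int [simp]: "zpair (of_int k) \<in> (Z_pos :: 'a::infinite zpair set) \<longleftrightarrow> 0 \<le> k"
proof -
  have "zpair (of_int k) \<in> (Z_pos :: 'a zpair set) \<longleftrightarrow> nat (- k) \<le> nat k"
    unfolding Z_pos_def by (simp, simp add: zpair_of_int)
  then show ?thesis by auto
qed

lemma zle_zero_iff: "zle \<zero>\<^bsub>Z_ring\<^esub> (zpair p) \<longleftrightarrow> zpair p \<in> (Z_pos :: 'a::infinite zpair set)"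
proof -
  have "zle (0, 0) a \<longleftrightarrow> a \<in> Z_pos" if "a \<in> Z_inf" for a :: "'a zpair"
    by (auto simp: zle_def Z_pos_def Z_neg_def Z_inf_def)
  then show ?thesis by (simp add: Z_ring_def)
qed

text \<open>Natural sum is strictly increasing in each argument, so among exponents bounded by \<mu>
  and \<nu> only the pair (\<mu>, \<nu>) reaches \<mu> + \<nu>.\<close>

lemma lookup_times_max:
  fixes p q :: "'a::infinite zpoly"
  assumes "\<And>\<eta>. \<mu> < \<eta> \<Longrightarrow> lookup p \<eta> = 0" "\<And>\<eta>. \<nu> < \<eta> \<Longrightarrow> lookup q \<eta> = 0"
  shows "lookup (p * q) (\<mu> + \<nu>) = lookup p \<mu> * lookup q \<nu>"
proof -
  have "\<zeta> = \<mu> \<and> \<eta> = \<nu>" if "\<zeta> + \<eta> = \<mu> + \<nu>" "\<zeta> \<le> \<mu>" "\<eta> \<le> \<nu>" for \<zeta> \<eta>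
    using that add_less_le_mono[of \<zeta> \<mu> \<eta> \<nu>] add_le_less_mono[of \<zeta> \<mu> \<eta> \<nu>] by (metis le_less less_irrefl)
  moreover have "\<zeta> \<le> \<mu>" if "\<zeta> \<in> supp (lookup p)" for \<zeta>
    using that assms(1)[of \<zeta>] by (auto simp: supp_def intro: leI)
  moreover have "\<eta> \<le> \<nu>" if "\<eta> \<in> supp (lookup q)" for \<eta>
    using that assms(2)[of \<eta>] by (auto simp: supp_def intro: leI)
  ultimately have "{(\<zeta>, \<eta>) \<in> supp (lookup p) \<times> supp (lookup q). \<zeta> + \<eta> = \<mu> + \<nu>} \<subseteq> {(\<mu>, \<nu>)}"
    by blast
  then have "(\<Sum>(\<zeta>, \<eta>) \<in> {(\<zeta>, \<eta>) \<in> supp (lookup p) \<times> supp (lookup q). \<zeta> + \<eta> = \<mu> + \<nu>}. lookup p \<zeta> * lookup q \<eta>)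
    = (\<Sum>(\<zeta>, \<eta>) \<in> {(\<mu>, \<nu>)}. lookup p \<zeta> * lookup q \<eta>)"
    by (intro sum.mono_neutral_left) (auto simp: supp_def)
  then show ?thesis
    by (simp add: lookup_times_convolution convolution_def flip: plus_ordinal_def)
qed

lemma zpoly_unit:
  fixes p :: "'a::infinite zpoly"
  assumes "p dvd 1"
  shows "p = 1 \<or> p = - 1"
proof -
  from assms obtain q where pq: "p * q = 1" by (metis dvdE)
  then have "p \<noteq> 0" "q \<noteq> 0" by auto
  then have p: "lookup p \<noteq> (\<lambda>_. 0)" and q: "lookup q \<noteq> (\<lambda>_. 0)"
    by (auto simp: poly_mapping_eq_iff zero_poly_mapping.rep_eq)
  obtain \<mu> where \<mu>: "lookup p \<mu> \<noteq> 0" "\<And>\<eta>. \<mu> < \<eta> \<Longrightarrow> lookup p \<eta> = 0"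
    by (rule supp_max_ex[OF finite_supp_lookup p]) (rule that)
  obtain \<nu> where \<nu>: "lookup q \<nu> \<noteq> 0" "\<And>\<eta>. \<nu> < \<eta> \<Longrightarrow> lookup q \<eta> = 0"
    by (rule supp_max_ex[OF finite_supp_lookup q]) (rule that)
  have "lookup (p * q) (\<mu> + \<nu>) = lookup p \<mu> * lookup q \<nu>"
    using \<mu>(2) \<nu>(2) by (rule lookup_times_max)
  \<comment> \<open>The product of the two top coefficients is a nonzero integer, and the constant 1
    has a nonzero coefficient only at exponent 0.\<close>
  then have "\<mu> + \<nu> = 0"
    using \<mu>(1) \<nu>(1) by (auto simp: pq lookup_one when_def split: if_splits)
  then have "\<mu> = 0" "\<nu> = 0"
    by (simp_all add: add_nonneg_eq_0_iff)
  then have "p = of_int (lookup p 0)" "q = of_int (lookup q 0)"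
    using \<mu>(2) \<nu>(2) by (auto simp: poly_mapping_eq_iff fun_eq_iff lookup_of_int when_def)
  then have "of_int (lookup p 0 * lookup q 0) = (1 :: 'a zpoly)"
    using pq by (metis of_int_mult)
  then have "lookup p 0 * lookup q 0 = 1"
    by (simp only: of_int_eq_1_iff)
  then have "lookup p 0 = 1 \<or> lookup p 0 = - 1"
    by (auto simp: zmult_eq_1_iff)
  then show ?thesis
    using \<open>p = of_int (lookup p 0)\<close> by (metis of_int_1 of_int_minus)
qed

section \<open>Fractions\<close>

lemma Q_inf_zpair_iff:
  "(zpair a, zpair b) \<in> Q_inf \<longleftrightarrow> zpair b \<in> Z_pos \<and> b \<noteq> 0 \<and>
     (\<forall>d :: 'a::infinite zpoly. d dvd a \<and> d dvd b \<longrightarrow> d = 1 \<or> d = - 1)"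
  by (simp add: Q_inf_def Z_ring_zero Z_ring_one Z_inf_eq_range)

lemma qequiv_zpair_iff:
  "qequiv (zpair a, zpair b) (zpair c, zpair d) \<longleftrightarrow>
     (\<exists>u v :: 'a::infinite zpoly. u \<noteq> 0 \<and> v \<noteq> 0 \<and> u * a = v * c \<and> u * b = v * d)"
proof -
  have "Z_inf - {\<zero>\<^bsub>Z_ring\<^esub>} = (zpair ` (- {0}) :: 'a zpair set)"
    by (auto simp: Z_ring_zero Z_inf_eq_range simp del: Z_ring_carrier)
  then show ?thesis by (simp add: qequiv_def Bex_def conj_assoc)
qed

text \<open>Both reductions needed below (denominator 1, and pairs of integers) have a Bezout identity,
  so no unique factorisation in \<open>\<int>\<^sub>\<infinity>\<close> is required.\<close>

lemma qreduce_bezout: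
  fixes x y :: "'a::infinite zpoly"
  assumes bezout: "s * x + t * y = 1" and g: "g \<noteq> 0"
    and y: "zpair y \<in> Z_pos" "zpair (- y) \<notin> Z_pos"
  shows "(zpair x, zpair y) \<in> Q_inf" "qreduce (zpair (g * x), zpair (g * y)) = (zpair x, zpair y)"
proof -
  have "y \<noteq> 0" using y by auto
  moreover have "d = 1 \<or> d = - 1" if "d dvd x" "d dvd y" for d
    \<comment> \<open>A common divisor of \<open>x\<close> and \<open>y\<close> divides the Bezout
      combination, which is 1.\<close>
    by (rule zpoly_unit) (use that in \<open>simp flip: bezout\<close>)
  ultimately show mem: "(zpair x, zpair y) \<in> Q_inf"
    using y by (simp add: Q_inf_zpair_iff)
  show "qreduce (zpair (g * x), zpair (g * y)) = (zpair x, zpair y)"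
    unfolding qreduce_def
  proof (rule the_equality, rule conjI)
    show "qequiv (zpair (g * x), zpair (g * y)) (zpair x, zpair y)"
      unfolding qequiv_zpair_iff using g by (intro exI[of _ 1] exI[of _ g]) simp
    fix r assume r: "r \<in> Q_inf \<and> qequiv (zpair (g * x), zpair (g * y)) r"
    then obtain a b where ab: "r = (zpair a, zpair b)"
      by (cases r) (auto simp: Q_inf_def Z_pos_def Z_inf_eq_range)
    from r obtain u v where uv: "u \<noteq> 0" "v \<noteq> 0" "u * (g * x) = v * a" "u * (g * y) = v * b"
      unfolding ab qequiv_zpair_iff by blast
    have "v * (a * y) = (u * (g * x)) * y" unfolding uv(3) by (simp only: mult.assoc)
    also have "\<dots> = (u * (g * y)) * x" by (simp only: ac_simps)
    also have "\<dots> = v * (b * x)" unfolding uv(4) by (simp only: mult.assoc)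
    finally have "v * (a * y) = v * (b * x)" .
    \<comment> \<open>Cancelling \<open>v\<close> relies on the absence of zero divisors.\<close>
    then have cross: "a * y = b * x" using uv(2) by simp
    \<comment> \<open>If \<open>(a, b)\<close> is \<open>k\<close> times \<open>(x, y)\<close>, the
      Bezout identity forces this value of \<open>k\<close>. As a common divisor of \<open>a\<close>
      and \<open>b\<close> it must then be 1 or -1.\<close>
    define k where "k = s * a + t * b"
    have "a = a * (s * x + t * y)" by (simp add: bezout)
    also have "\<dots> = s * a * x + t * (a * y)" by (simp only: algebra_simps)
    also have "\<dots> = x * k" unfolding k_def cross by (simp only: algebra_simps)
    finally have a: "a = x * k" .
    have "b = b * (s * x + t * y)" by (simp add: bezout)
    also have "\<dots> = s * (b * x) + t * b * y" by (simp only: algebra_simps)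
    also have "\<dots> = y * k" unfolding k_def cross[symmetric] by (simp only: algebra_simps)
    finally have b: "b = y * k" .
    have "k = 1 \<or> k = - 1" "zpair b \<in> Z_pos"
      using r unfolding ab Q_inf_zpair_iff by (simp_all add: a b)
    then show "r = (zpair x, zpair y)"
      \<comment> \<open>For \<open>k = - 1\<close> the denominator \<open>b\<close> would be
        \<open>- y\<close>, which is not in \<open>Z_pos\<close>.\<close>
      using y by (auto simp: ab a b)
  qed (rule mem)
qed

section \<open>Fractions with denominator 1 and the case \<omega> < \<kappa>\<close>

definition zfrac :: "'a zpoly \<Rightarrow> 'a qpair" where
  "zfrac p = (zpair p, zpair 1)"

lemma zpair_one_pos: "zpair 1 \<in> (Z_pos :: 'a::infinite zpair set)" "zpair (- 1) \<notin> (Z_pos :: 'a zpair set)"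
  using Z_pos_of_int[of 1, where ?'a = 'a] Z_pos_of_int[of "- 1", where ?'a = 'a] by simp_all

lemma zfrac_in_Q_inf: "zfrac p \<in> (Q_inf :: 'a::infinite qpair set)"
  unfolding zfrac_def by (rule qreduce_bezout(1)[of 0 _ 1 _ 1]) (simp_all add: zpair_one_pos)

lemma qadd_zfrac: "qadd (zfrac p) (zfrac q) = zfrac (p + q :: 'a::infinite zpoly)"
  using qreduce_bezout(2)[of 0 "p + q" 1 1 1] by (simp add: qadd_def zfrac_def zpair_one_pos)

lemma qle_zfrac_iff: "qle (zfrac p) (zfrac q) \<longleftrightarrow> zpair (q - p) \<in> (Z_pos :: 'a::infinite zpair set)"
proof -
  have "qneg (zfrac p) = zfrac (- p)" by (simp add: qneg_def zfrac_def)
  then show ?thesis by (simp add: qle_def qadd_zfrac) (simp add: zfrac_def zle_zero_iff)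
qed

definition ordinal_poly :: "'a ordinal \<Rightarrow> 'a zpoly" where
  "ordinal_poly \<alpha> = Abs_poly_mapping (\<lambda>\<zeta>. int (cnf \<alpha> \<zeta>))"

lemma lookup_ordinal_poly: "lookup (ordinal_poly \<alpha>) = (\<lambda>\<zeta>. int (cnf (\<alpha> :: 'a::infinite ordinal) \<zeta>))"
  unfolding ordinal_poly_def
  by (rule lookup_Abs_poly_mapping) (use finite_supp_cnf[of \<alpha>] in \<open>simp add: supp_def\<close>)

lemma zpair_ordinal_poly: "zpair (ordinal_poly \<alpha>) = (0, \<alpha> :: 'a::infinite ordinal)"
  by (simp add: zpair_def of_zcoeff_def lookup_ordinal_poly)

lemma ordinal_poly_of_nat: "ordinal_poly (ord_of_nat n) = (of_nat n :: 'a::infinite zpoly)"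
  by (auto simp: poly_mapping_eq_iff fun_eq_iff lookup_ordinal_poly cnf_ord_of_nat lookup_of_nat)

text \<open>At the top exponent where \<alpha> and \<beta> differ the difference is negative, so its
  negative part is the larger ordinal.\<close>

lemma ordinal_poly_diff_neg:
  assumes "\<alpha> < (\<beta> :: 'a::infinite ordinal)"
  shows "zpair (ordinal_poly \<alpha> - ordinal_poly \<beta>) \<notin> Z_pos"
proof -
  let ?p = "lookup (ordinal_poly \<alpha> - ordinal_poly \<beta>)"
  have p: "?p \<zeta> = int (cnf \<alpha> \<zeta>) - int (cnf \<beta> \<zeta>)" for \<zeta>
    by (simp add: lookup_minus lookup_ordinal_poly)
  obtain \<zeta> where "cnf \<alpha> \<zeta> < cnf \<beta> \<zeta>" "\<And>\<eta>. \<zeta> < \<eta> \<Longrightarrow> cnf \<alpha> \<eta> = cnf \<beta> \<eta>"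
    using less_ordinal_iff_lex_less[of \<alpha> \<beta>] assms by (auto simp: lex_less_def)
  then have "lex_less (\<lambda>\<zeta>. nat (?p \<zeta>)) (\<lambda>\<zeta>. nat (- ?p \<zeta>))"
    unfolding lex_less_def p by (intro exI[of _ \<zeta>]) auto
  then have "snd (of_zcoeff ?p) < fst (of_zcoeff ?p)"
    unfolding of_zcoeff_def by (simp add: cnf_sum_less_iff finite_supp_nat)
  then show ?thesis by (simp add: Z_pos_def zpair_def not_le)
qed

lemma not_archimedean_if_greater_omega:
  fixes \<kappa> :: "'a::infinite ordinal"
  assumes "omega < \<kappa>"
  shows "\<not> archimedean (Q_field \<kappa>)"
proof
  assume arch: "archimedean (Q_field \<kappa>)"
  define w :: "'a zpoly" where "w = ordinal_poly omega"
  have zero: "\<zero>\<^bsub>Q_field \<kappa>\<^esub> = zfrac 0"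
    by (simp add: Q_field_def zfrac_def Z_ring_zero Z_ring_one)
  \<comment> \<open>Writing 1 as an \<open>ordinal_poly\<close> lets the facts on carrier, absolute
    value and nonvanishing serve both 1 and \<omega>; it also puts the denominator of
    \<open>zfrac\<close> below \<kappa>.\<close>
  have one: "1 = (ordinal_poly (ord_of_nat 1) :: 'a zpoly)"
    unfolding ordinal_poly_of_nat by simp
  have lt: "ord_of_nat n < \<kappa>" for n
    using ord_of_nat_less_omega assms by (rule less_trans)
  have zlt: "0 < \<kappa>" using lt[of 0] by simp
  have carrier: "zfrac (ordinal_poly \<alpha>) \<in> carrier (Q_field \<kappa>)" if "\<alpha> < \<kappa>" for \<alpha>
  proof -
    have "zpair (ordinal_poly \<beta>) \<in> Z_below \<kappa>" if "\<beta> < \<kappa>" for \<beta>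
      using zpair_in_Z_inf[of "ordinal_poly \<beta>"] that zlt
      by (simp add: Z_below_def zpair_ordinal_poly)
    then show ?thesis
      using zfrac_in_Q_inf[of "ordinal_poly \<alpha>"] that lt[of 1]
      by (auto simp: Q_field_def Q_below_def zfrac_def one simp del: ord_of_nat.simps)
  qed
  have abs: "ring_abs (Q_field \<kappa>) (zfrac (ordinal_poly \<alpha>)) = zfrac (ordinal_poly \<alpha>)" for \<alpha>
  proof -
    have "zpair (ordinal_poly \<alpha>) \<in> Z_pos"
      using zpair_in_Z_inf[of "ordinal_poly \<alpha>"] by (simp add: Z_pos_def zpair_ordinal_poly)
    then show ?thesis
      by (simp add: ring_abs_def zero) (simp add: Q_field_def qle_zfrac_iff)
  qed
  have pow: "[n] \<cdot>\<^bsub>Q_field \<kappa>\<^esub> zfrac 1 = zfrac (of_nat n)" for n :: nat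
    by (induction n) (simp_all add: add_pow_def zero, simp add: Q_field_def qadd_zfrac add.commute)
  have ne: "zfrac (ordinal_poly \<alpha>) \<noteq> zfrac 0" if "\<alpha> \<noteq> 0" for \<alpha> :: "'a ordinal"
    using that zpair_ordinal_poly[of \<alpha>] zpair_of_int[of 0, where ?'a = 'a]
    by (auto simp: zfrac_def)
  have "zfrac 1 \<in> carrier (Q_field \<kappa>) - {\<zero>\<^bsub>Q_field \<kappa>\<^esub>}" "zfrac w \<in> carrier (Q_field \<kappa>) - {\<zero>\<^bsub>Q_field \<kappa>\<^esub>}"
    using carrier ne lt[of 1] assms ord_of_nat_less_omega[of 0, where ?'a = 'a]
    by (auto simp: zero w_def one)
  then obtain n :: nat where
    "ring_le (Q_field \<kappa>) (ring_abs (Q_field \<kappa>) (zfrac w)) ([n] \<cdot>\<^bsub>Q_field \<kappa>\<^esub> ring_abs (Q_field \<kappa>) (zfrac 1))"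
    using arch unfolding archimedean_def by blast
  then have "ring_le (Q_field \<kappa>) (zfrac w) (zfrac (of_nat n))"
    using abs[of "ord_of_nat 1"] abs[of omega] by (simp only: pow w_def flip: one)
  then have "zpair (ordinal_poly (ord_of_nat n) - ordinal_poly omega) \<in> (Z_pos :: 'a zpair set)"
    by (simp add: Q_field_def qle_zfrac_iff ordinal_poly_of_nat w_def)
  then show False
    using ordinal_poly_diff_neg[OF ord_of_nat_less_omega] by blast
qed

section \<open>Pairs of integers as rational numbers and the case \<kappa> = \<omega>\<close>

lemma Q_inf_of_int_iff:
  "(zpair (of_int a), zpair (of_int b)) \<in> (Q_inf :: 'a::infinite qpair set) \<longleftrightarrow> 0 < b \<and> coprime a b"
proof
  assume Q: "(zpair (of_int a), zpair (of_int b)) \<in> (Q_inf :: 'a qpair set)"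
  then have "0 < b" by (auto simp: Q_inf_zpair_iff)
  \<comment> \<open>The integer gcd, read as a constant of the monoid algebra, is a common divisor
    there; reducedness makes it 1 or -1.\<close>
  moreover have "of_int (gcd a b) dvd (of_int k :: 'a zpoly)" if "gcd a b dvd k" for k
    using that by (metis dvdE dvd_triv_left of_int_mult)
  then have "of_int (gcd a b) = (1 :: 'a zpoly) \<or> of_int (gcd a b) = (- 1 :: 'a zpoly)"
    using Q by (auto simp: Q_inf_zpair_iff)
  then have "gcd a b = 1 \<or> gcd a b = - 1"
    by (metis of_int_eq_iff of_int_1 of_int_minus)
  then have "coprime a b"
    using gcd_ge_0_int[of a b] by (auto simp: coprime_iff_gcd_eq_1)
  ultimately show "0 < b \<and> coprime a b" by simp
next
  assume *: "0 < b \<and> coprime a b"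
  then obtain s t where "s * a + t * b = 1"
    by (metis bezout_int coprime_imp_gcd_eq_1)
  then have "of_int s * of_int a + of_int t * of_int b = (1 :: 'a zpoly)"
    by (metis of_int_1 of_int_add of_int_mult)
  then show "(zpair (of_int a), zpair (of_int b)) \<in> (Q_inf :: 'a qpair set)"
    by (rule qreduce_bezout(1)[where g = 1])
      (use * Z_pos_of_int[of "- b", where ?'a = 'a] in \<open>simp_all\<close>)
qed

text \<open>\<open>quotient_of\<close> returns coprime integers with positive denominator. This is
  exactly the normal form that \<open>Q_inf\<close> demands of pairs of integers, so no further
  reduction intervenes.\<close>

definition of_rat_pair :: "rat \<Rightarrow> 'a::infinite qpair" where
  "of_rat_pair r = map_prod (zpair \<circ> of_int) (zpair \<circ> of_int) (quotient_of r)"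

text \<open>Dividing by the integer gcd leaves a pair with a Bezout identity over the integers,
  which remains valid in the monoid algebra. The same division normalizes
  \<open>Fract a b\<close>.\<close>

lemma qreduce_of_int:
  assumes "0 < b"
  shows "qreduce (zpair (of_int a), zpair (of_int b)) = (of_rat_pair (Fract a b) :: 'a::infinite qpair)"
proof -
  define g where "g = gcd a b"
  have g: "g > 0" using assms by (simp add: g_def)
  have coprime: "coprime (a div g) (b div g)"
    using assms by (simp add: g_def div_gcd_coprime)
  have ab: "a = g * (a div g)" "b = g * (b div g)"
    by (simp_all add: g_def)
  have b': "b div g > 0" using g assms ab by (metis zero_less_mult_pos)
  obtain s t where "s * (a div g) + t * (b div g) = 1"
    using coprime by (metis bezout_int coprime_imp_gcd_eq_1)
  then have "of_int s * of_int (a div g) + of_int t * of_int (b div g) = (1 :: 'a zpoly)"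
    by (metis of_int_1 of_int_add of_int_mult)
  from qreduce_bezout(2)[OF this, of "of_int g"]
  have "qreduce (zpair (of_int (g * (a div g))), zpair (of_int (g * (b div g)))) =
      (zpair (of_int (a div g)), zpair (of_int (b div g)) :: 'a zpair)"
    using g b' Z_pos_of_int[of "- (b div g)", where ?'a = 'a] by simp
  moreover have "quotient_of (Fract a b) = (a div g, b div g)"
    using assms by (simp add: quotient_of_Fract Rat.normalize_def g_def Let_def)
  ultimately show ?thesis
    by (simp add: of_rat_pair_def flip: ab)
qed

lemma of_rat_pair_Fract:
  assumes "quotient_of r = (a, b)"
  shows "(of_rat_pair r :: 'a::infinite qpair) = (zpair (of_int a), zpair (of_int b))" "r = Fract a b" "0 < b"
  using assms quotient_of_denom_pos[OF assms] quotient_of_div[OF assms]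
  by (simp_all add: of_rat_pair_def Fract_of_int_quotient)

lemma qadd_of_rat_pair: "qadd (of_rat_pair r) (of_rat_pair s) = (of_rat_pair (r + s) :: 'a::infinite qpair)"
proof -
  obtain a b where r: "quotient_of r = (a, b)" by fastforce
  obtain c d where s: "quotient_of s = (c, d)" by fastforce
  note r = of_rat_pair_Fract[OF r] and s = of_rat_pair_Fract[OF s]
  have "qadd (of_rat_pair r) (of_rat_pair s) = qreduce (zpair (of_int (a * d + b * c)), zpair (of_int (b * d)) :: 'a zpair)"
    by (simp add: qadd_def r(1) s(1))
  also have "\<dots> = of_rat_pair (Fract (a * d + b * c) (b * d))"
    using r(3) s(3) by (intro qreduce_of_int) simp
  also have "Fract (a * d + b * c) (b * d) = r + s"
    using r(2,3) s(2,3) by (simp add: mult.commute)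
  finally show ?thesis .
qed

lemma qle_of_rat_pair: "qle (of_rat_pair r) (of_rat_pair s :: 'a::infinite qpair) \<longleftrightarrow> r \<le> s"
proof -
  obtain a b where ab: "quotient_of (s - r) = (a, b)" by fastforce
  have "qneg (of_rat_pair r :: 'a qpair) = of_rat_pair (- r)"
    by (simp add: qneg_def of_rat_pair_def rat_uminus_code case_prod_beta)
  then have "qle (of_rat_pair r) (of_rat_pair s :: 'a qpair) \<longleftrightarrow> 0 \<le> a"
    using of_rat_pair_Fract(1)[OF ab, where ?'a = 'a] by (simp add: qle_def qadd_of_rat_pair zle_zero_iff)
  also have "\<dots> \<longleftrightarrow> 0 \<le> s - r"
    using of_rat_pair_Fract(2,3)[OF ab] by (simp add: zero_le_Fract_iff)
  finally show ?thesis by simp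
qed

lemma inj_of_rat_pair: "inj (of_rat_pair :: rat \<Rightarrow> 'a::infinite qpair)"
proof (rule injI)
  fix r s assume eq: "(of_rat_pair r :: 'a qpair) = of_rat_pair s"
  obtain a b where r: "quotient_of r = (a, b)" by fastforce
  obtain c d where s: "quotient_of s = (c, d)" by fastforce
  note r = of_rat_pair_Fract[OF r] and s = of_rat_pair_Fract[OF s]
  from eq have "a = c" "b = d"
    by (simp_all add: r(1) s(1))
  then show "r = s" by (simp add: r(2) s(2))
qed

lemma Z_below_omega: "Z_below omega = range (\<lambda>k. zpair (of_int k) :: 'a::infinite zpair)"
proof (intro equalityI subsetI)
  fix a :: "'a zpair" assume a: "a \<in> Z_below omega"
  then obtain m n where mn: "a = (ord_of_nat m, ord_of_nat n)"
    by (cases a) (auto simp: Z_below_def less_omega_iff)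
  \<comment> \<open>Two nonzero finite ordinals would share the exponent 0.\<close>
  then have "m = 0 \<or> n = 0"
    using a by (auto simp: Z_below_def Z_inf_def cnf_ord_of_nat supp_def)
  then have "a = zpair (of_int (int n - int m))"
    unfolding zpair_of_int mn by auto
  then show "a \<in> range (\<lambda>k. zpair (of_int k))" by blast
next
  fix a :: "'a zpair" assume "a \<in> range (\<lambda>k. zpair (of_int k))"
  then obtain k where k: "a = zpair (of_int k)" by blast
  show "a \<in> Z_below omega"
    unfolding Z_below_def mem_Collect_eq by (rule conjI, simp add: k, simp add: k zpair_of_int)
qed

lemma Q_below_omega: "Q_below omega = range (of_rat_pair :: rat \<Rightarrow> 'a::infinite qpair)"
proof (intro equalityI subsetI)
  fix p :: "'a qpair" assume "p \<in> Q_below omega"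
  then obtain a b where p: "p = (zpair (of_int a), zpair (of_int b))" "p \<in> Q_inf"
    by (auto simp: Q_below_def Z_below_omega)
  then have "0 < b" "coprime a b" by (simp_all add: Q_inf_of_int_iff)
  then have "quotient_of (Fract a b) = (a, b)"
    by (simp add: quotient_of_Fract normalize_stable)
  then have "p = of_rat_pair (Fract a b)"
    using p(1) by (simp add: of_rat_pair_def)
  then show "p \<in> range of_rat_pair" by blast
next
  fix p :: "'a qpair" assume "p \<in> range of_rat_pair"
  then obtain r where r: "p = of_rat_pair r" by blast
  obtain a b where ab: "quotient_of r = (a, b)" by fastforce
  have "p = (zpair (of_int a), zpair (of_int b))"
    unfolding r by (rule of_rat_pair_Fract(1)[OF ab])
  then show "p \<in> Q_below omega"
    using quotient_of_coprime[OF ab] quotient_of_denom_pos[OF ab]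
    by (simp add: Q_below_def Z_below_omega Q_inf_of_int_iff)
qed

lemma archimedean_omega: "archimedean (Q_field (omega :: 'a::infinite ordinal))"
proof -
  let ?F = "Q_field (omega :: 'a ordinal)"
  let ?q = "of_rat_pair :: rat \<Rightarrow> 'a qpair"
  have carrier: "carrier ?F = range ?q"
    by (simp add: Q_field_def Q_below_omega)
  have zero: "\<zero>\<^bsub>?F\<^esub> = ?q 0"
    by (simp add: Q_field_def Z_ring_zero Z_ring_one of_rat_pair_def)
  have add: "?q r \<oplus>\<^bsub>?F\<^esub> ?q s = ?q (r + s)" for r s
    by (simp add: Q_field_def qadd_of_rat_pair)
  have le: "ring_le ?F (?q r) (?q s) \<longleftrightarrow> r \<le> s" for r s
    by (simp add: Q_field_def qle_of_rat_pair)
  \<comment> \<open>The ring inverse is a definite description; injectivity of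
    \<open>of_rat_pair\<close> makes the candidate \<open>- r\<close> unique.\<close>
  have inv: "\<ominus>\<^bsub>?F\<^esub> ?q r = ?q (- r)" for r
    unfolding a_inv_def m_inv_def
    by (rule the_equality) (auto simp: carrier zero add inj_eq[OF inj_of_rat_pair])
  have abs: "ring_abs ?F (?q r) = ?q \<bar>r\<bar>" for r
    by (simp add: ring_abs_def zero le inv abs_if)
  have pow: "[n] \<cdot>\<^bsub>?F\<^esub> ?q r = ?q (of_nat n * r)" for n :: nat and r
    by (induction n) (simp_all add: add_pow_def zero add algebra_simps)
  have arch: "\<exists>n::nat. \<bar>s\<bar> \<le> of_nat n * \<bar>r\<bar> \<and> \<bar>r\<bar> \<le> of_nat n * \<bar>s\<bar>" if "r \<noteq> 0" "s \<noteq> 0" for r s :: rat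
  proof -
    \<comment> \<open>One \<open>n\<close> has to serve both inequalities, so it is taken above both
      quotients.\<close>
    obtain n :: nat where "max (\<bar>s\<bar> / \<bar>r\<bar>) (\<bar>r\<bar> / \<bar>s\<bar>) \<le> of_nat n"
      using real_arch_simple by blast
    then show ?thesis
      using that by (intro exI[of _ n]) (simp add: divide_le_eq)
  qed
  have "carrier ?F - {\<zero>\<^bsub>?F\<^esub>} = ?q ` (- {0})"
    by (auto simp: carrier zero inj_eq[OF inj_of_rat_pair] simp del: split_paired_All)
  then show ?thesis
    using arch by (simp add: archimedean_def abs pow le)
qed

theorem theorem6:
  fixes \<kappa> :: "'a::infinite ordinal"
  assumes "transfinite_times_number \<kappa>"
  shows "archimedean (Q_field \<kappa>) \<longleftrightarrow> \<kappa> = omega"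
  using assms archimedean_omega not_archimedean_if_greater_omega[of \<kappa>]
  by (auto simp: transfinite_times_number_def le_less)

end
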